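(* Let $f(z)=z+\sum_{n=2}^{\infty}a_nz^n\in\mathcal{C}_1$ and let $N\ge 2$ be an integer. Then $$|f(z)|^2+\sum_{n=N}^{\infty}|a_nz^n|\le d(f(0),\partial f(\mathbb{D}))$$ for $|z|\le r_{2,N}$, where $r_{2,N}$ is the solution in $(0,1)$ of $$\left(\frac{2r}{1-r}+\log(1-r)\right)^2+\sum_{n=N}^{\infty}\left(2-\frac1n\right)r^{n}-(1-\log 2)=0.$$ The result is sharp, i.e. for each $N\ge2$ the number $r_{2,N}$ cannot be replaced by any larger number such that the inequality still holds for all $f\in\mathcal{C}_1$.
   Context: $\mathbb{D}=\{z\in\mathbb{C}:|z|<1\}$; $d$ is the Euclidean distance and $\partial f(\mathbb{D})$ is the boundary of $f(\mathbb{D})$. A convex function is a univalent analytic function on $\mathbb{D}$ whose image is a convex domain. The class $\mathcal{C}_1$ consists of the analytic functions $f(z)=z+\sum_{n=2}^\infty a_nz^n$ on $\mathbb{D}$ for which there exists a convex function $g(z)=b_1z+\cdots$ with $\operatorname{Re}(b_1)>0$ such that $\operatorname{Re}\left(\frac{zf'(z)}{g(z)}\right)>0$ for all $z\in\mathbb{D}$ (the quotient being extended analytically to $z=0$). *)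

theory Defs
  imports "HOL-Complex_Analysis.Complex_Analysis"
begin

abbreviation unit_disc :: "complex set" ("\<D>")
  where "\<D> \<equiv> ball 0 1"

definition convex_function :: "(complex \<Rightarrow> complex) \<Rightarrow> bool"
  where "convex_function g \<longleftrightarrow>
    g holomorphic_on \<D> \<and> inj_on g \<D> \<and> convex (g ` \<D>)"

text \<open>
  The conditions \<open>f 0 = 0\<close> and \<open>deriv f 0 = 1\<close> are the normalization
  \<open>f(z) = z + a\<^sub>2 z\<^sup>2 + \<dots>\<close>, and \<open>g 0 = 0\<close> is the form \<open>g(z) = b\<^sub>1 z + \<dots>\<close> with
  \<open>b\<^sub>1 = deriv g 0\<close>. The function \<open>q\<close> is the analytic extension of \<open>z f'(z) / g(z)\<close> to \<open>z = 0\<close>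
  (as a HOL term the quotient itself has the value 0 there).
\<close>

definition class_C1 :: "(complex \<Rightarrow> complex) set" ("\<C>\<^sub>1")
  where "\<C>\<^sub>1 = {f. f holomorphic_on \<D> \<and> f 0 = 0 \<and> deriv f 0 = 1 \<and>
    (\<exists>g. convex_function g \<and> g 0 = 0 \<and> Re (deriv g 0) > 0 \<and>
      (\<exists>q. q holomorphic_on \<D> \<and>
           (\<forall>z\<in>\<D> - {0}. q z = z * deriv f z / g z) \<and>
           (\<forall>z\<in>\<D>. Re (q z) > 0)))}"

abbreviation taylor_coeff :: "(complex \<Rightarrow> complex) \<Rightarrow> nat \<Rightarrow> complex"
  where "taylor_coeff f n \<equiv> fps_nth (fps_expansion f 0) n"

text \<open>Tails of series over \<open>n \<ge> N\<close> are written with the index shifted by \<open>N\<close>.\<close>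

definition bohr_inequality :: "nat \<Rightarrow> (complex \<Rightarrow> complex) \<Rightarrow> complex \<Rightarrow> bool"
  where "bohr_inequality N f z \<longleftrightarrow>
    (cmod (f z))\<^sup>2 + (\<Sum>n. cmod (taylor_coeff f (n + N) * z ^ (n + N)))
      \<le> infdist (f 0) (frontier (f ` \<D>))"

definition radius_equation :: "nat \<Rightarrow> real \<Rightarrow> bool"
  where "radius_equation N r \<longleftrightarrow>
    (2 * r / (1 - r) + ln (1 - r))\<^sup>2
      + (\<Sum>n. (2 - 1 / real (n + N)) * r ^ (n + N)) - (1 - ln 2) = 0"

end

theory Submission imports Defs begin

text \<open>
  A convex function \<open>g\<close> with \<open>g 0 = 0\<close> has \<open>|b\<^sub>n| \<le> |b\<^sub>1|\<close> and \<open>|g z| \<ge> |b\<^sub>1| |z| / (1 + |z|)\<close>, and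
  \<open>q\<close>, having values in a half-plane, has \<open>|q\<^sub>n| \<le> 2 |q\<^sub>0|\<close> and \<open>|q z| \<ge> |q\<^sub>0| (1 - |z|) / (1 + |z|)\<close>;
  all of this comes from the Schwarz lemma. From \<open>z f'(z) = q z g z\<close> one gets \<open>|a\<^sub>n| \<le> 2 - 1/n\<close>,
  so that the left-hand side is at most \<open>(2r/(1-r) + ln (1-r))\<^sup>2 + \<Sum>\<^sub>n\<^sub>\<ge>\<^sub>N (2 - 1/n) r\<^sup>n\<close>, and
  \<open>|f' z| \<ge> (1 - |z|) / (1 + |z|)\<^sup>2\<close>, whose integral over \<open>[0, 1]\<close> is \<open>1 - ln 2\<close>: the image of \<open>f\<close>
  contains the disc of that radius. The image is not the whole plane since \<open>f\<close> is univalent,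
  being joined to \<open>g\<close> by the functions \<open>s f + (1 - s) g\<close>, along which univalence is preserved.
  Equality holds for \<open>2z/(1-z) + Ln (1-z)\<close>, which arises from \<open>g z = z/(1-z)\<close> and
  \<open>q z = (1+z)/(1-z)\<close>.
\<close>

subsection \<open>Coefficients and subordination\<close>

text \<open>Cauchy's estimate on the disc of radius \<open>r < 1\<close>, followed by the limit
  \<open>r\<close> to 1 from the left.\<close>

lemma taylor_coeff_bounded:
  assumes h: "h holomorphic_on \<D>" and B: "\<And>z. z \<in> \<D> \<Longrightarrow> cmod (h z) \<le> B"
  shows "cmod (taylor_coeff h n) \<le> B"
proof -
  have "cmod (taylor_coeff h n) * r ^ n \<le> B" if r: "0 < r" "r < 1" for r :: real
  proof -
    have "cmod ((deriv ^^ n) h 0) \<le> fact n * B / r ^ n"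
    proof (rule Cauchy_inequality)
      show "h holomorphic_on ball 0 r" using h r by (auto elim!: holomorphic_on_subset)
      show "continuous_on (cball 0 r) h"
        using holomorphic_on_imp_continuous_on[OF h] r by (auto elim!: continuous_on_subset)
    qed (use r B in auto)
    then show ?thesis
      using r by (simp add: fps_expansion_def norm_divide field_simps)
  qed
  then have ev: "eventually (\<lambda>r. cmod (taylor_coeff h n) * r ^ n \<le> B) (at_left 1)"
    unfolding eventually_at_left_field by (intro exI[of _ "0::real"]) auto
  have "((\<lambda>r. cmod (taylor_coeff h n) * r ^ n) \<longlongrightarrow> cmod (taylor_coeff h n) * 1 ^ n) (at_left 1)"
    by (intro tendsto_intros)
  from tendsto_upperbound[OF this ev] show ?thesis by simp
qed

lemma disc_inverse:
  assumes "f holomorphic_on \<D>" "inj_on f \<D>"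
  shows "\<exists>fi. fi holomorphic_on f ` \<D> \<and> (\<forall>z\<in>\<D>. fi (f z) = z \<and> deriv f z * deriv fi (f z) = 1)"
  by (rule holomorphic_has_inverse[OF assms(1) open_ball assms(2)]) blast

lemma has_fps_expansion_disc:
  "k holomorphic_on \<D> \<Longrightarrow> k has_fps_expansion fps_expansion k 0"
  by (rule has_fps_expansion_fps_expansion[of "\<D>"]) auto

text \<open>As \<open>n\<close> does not divide \<open>m\<close>, the number \<open>w ^ m\<close> is
  an \<open>n\<close>-th root of unity other than 1, and the geometric sum vanishes.\<close>

lemma sum_root_unity_powers:
  fixes m n :: nat
  assumes "0 < m" "m < n"
  shows "(\<Sum>j<n. (cis (2 * pi / n) ^ j) ^ m) = 0"
proof -
  define w where "w = cis (2 * pi / n)"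
  have wn: "w ^ n = 1" using assms by (simp add: w_def Complex.DeMoivre)
  have "w ^ m = exp (2 * of_real pi * \<i> * of_nat m / of_nat n)"
    by (simp add: w_def cis_conv_exp mult_ac flip: exp_of_nat_mult)
  then have "w ^ m \<noteq> 1"
    using complex_root_unity_eq_1[of n m] assms by (auto dest: dvd_imp_le)
  then have "(\<Sum>j<n. (w ^ m) ^ j) = ((w ^ m) ^ n - 1) / (w ^ m - 1)"
    by (rule geometric_sum)
  also have "(w ^ m) ^ n = (w ^ n) ^ m" by (metis power_mult mult.commute)
  finally show ?thesis by (simp add: wn flip: w_def power_mult) (simp add: mult.commute)
qed

text \<open>Averaging \<open>k\<close> over rotations by the \<open>n\<close>-th roots of unity kills the coefficients of index
  between \<open>0\<close> and \<open>n\<close>, and convexity keeps the average subordinate to \<open>g\<close>.\<close>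

lemma subordinate_convex_coeff:
  assumes g: "convex_function g" and k: "k holomorphic_on \<D>"
    and sub: "k ` \<D> \<subseteq> g ` \<D>" and k0: "k 0 = g 0" and n: "n > 0"
  shows "cmod (taylor_coeff k n) \<le> cmod (deriv g 0)"
proof -
  have gh: "g holomorphic_on \<D>" and ginj: "inj_on g \<D>" and gc: "convex (g ` \<D>)"
    using g by (auto simp: convex_function_def)
  define w where "w = cis (2 * pi / n)"
  have wj: "cmod (w ^ j) = 1" for j by (simp add: w_def norm_power)
  define K where "K = fps_expansion k 0"
  have K: "k has_fps_expansion K" unfolding K_def by (rule has_fps_expansion_disc[OF k])
  define A where "A = (\<lambda>z. (\<Sum>j<n. k (w ^ j * z)) / of_nat n)"
  define FA where "FA = Abs_fps (\<lambda>m. (\<Sum>j<n. (w ^ j) ^ m) * fps_nth K m / of_nat n)"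
  have *: "(\<lambda>z. k (w ^ j * z)) has_fps_expansion Abs_fps (\<lambda>m. (w ^ j) ^ m * fps_nth K m)" for j
  proof -
    have "(k \<circ> (\<lambda>z. w ^ j * z)) has_fps_expansion fps_compose K (fps_const (w ^ j) * fps_X)"
      by (intro fps_expansion_intros K) auto
    then show ?thesis by (simp add: fps_compose_linear o_def)
  qed
  have "A has_fps_expansion (\<Sum>j<n. Abs_fps (\<lambda>m. (w ^ j) ^ m * fps_nth K m)) * fps_const (1 / of_nat n)"
  proof -
    have "(\<lambda>z. (\<Sum>j<n. k (w ^ j * z)) * (1 / of_nat n)) has_fps_expansion
        (\<Sum>j<n. Abs_fps (\<lambda>m. (w ^ j) ^ m * fps_nth K m)) * fps_const (1 / of_nat n)"
      by (intro fps_expansion_intros *)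
    then show ?thesis by (simp add: A_def)
  qed
  also have "(\<Sum>j<n. Abs_fps (\<lambda>m. (w ^ j) ^ m * fps_nth K m)) * fps_const (1 / of_nat n) = FA"
    by (rule fps_ext) (simp add: FA_def fps_sum_nth sum_distrib_right sum_divide_distrib)
  finally have A: "A has_fps_expansion FA" .
  have A0: "A 0 = g 0" using n by (simp add: A_def k0)
  have Ah: "A holomorphic_on \<D>"
  proof -
    have "(\<lambda>z. k (w ^ j * z)) holomorphic_on \<D>" for j
    proof -
      have "(k \<circ> (\<lambda>z. w ^ j * z)) holomorphic_on \<D>"
        by (rule holomorphic_on_compose_gen[OF _ k]) (auto intro!: holomorphic_intros simp: norm_mult wj)
      then show ?thesis by (simp add: o_def)
    qed
    then show ?thesis unfolding A_def using n by (intro holomorphic_intros) auto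
  qed
  have Ag: "A z \<in> g ` \<D>" if "z \<in> \<D>" for z
  proof -
    have "(\<Sum>j<n. (1 / real n) *\<^sub>R k (w ^ j * z)) \<in> g ` \<D>"
    proof (rule convex_sum[OF _ gc])
      show "k (w ^ j * z) \<in> g ` \<D>" for j using sub that by (auto simp: norm_mult wj image_subset_iff)
    qed (use n in auto)
    then show ?thesis by (simp add: A_def scaleR_conv_of_real sum_divide_distrib)
  qed
  obtain gi where gi_h: "gi holomorphic_on g ` \<D>" and gi: "\<And>z. z \<in> \<D> \<Longrightarrow> gi (g z) = z"
    using disc_inverse[OF gh ginj] by blast
  \<comment> \<open>The average factors as \<open>A = g \<circ> h\<close> with \<open>h\<close> a
    self-map of the disc fixing 0, so the coefficients of \<open>h\<close> are at most 1 in
    modulus.\<close>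
  define h where "h = gi \<circ> A"
  have hh: "h holomorphic_on \<D>"
    unfolding h_def by (rule holomorphic_on_compose_gen[OF Ah gi_h]) (use Ag in auto)
  have hD: "h z \<in> \<D>" and gh_eq: "g (h z) = A z" if "z \<in> \<D>" for z
    using Ag[OF that] gi by (auto simp: h_def)
  have h0: "h 0 = 0" using gi[of 0] by (simp add: h_def A0)
  define H where "H = fps_expansion h 0"
  define G where "G = fps_expansion g 0"
  have H: "h has_fps_expansion H" unfolding H_def by (rule has_fps_expansion_disc[OF hh])
  have G: "g has_fps_expansion G" unfolding G_def by (rule has_fps_expansion_disc[OF gh])
  have H0: "fps_nth H 0 = 0" using h0 by (simp add: H_def fps_expansion_def)
  have G1: "fps_nth G 1 = deriv g 0" by (simp add: G_def fps_expansion_def)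
  have "(g \<circ> h) has_fps_expansion fps_compose G H"
    by (rule has_fps_expansion_compose[OF G H H0])
  moreover have "A has_fps_expansion fps_compose G H \<longleftrightarrow> (g \<circ> h) has_fps_expansion fps_compose G H"
    using eventually_nhds_in_open[of "\<D>" 0]
    by (intro has_fps_expansion_cong) (auto simp: gh_eq elim!: eventually_mono)
  ultimately have GH: "fps_compose G H = FA"
    using A fps_expansion_unique_complex by blast
  \<comment> \<open>Splitting off one factor \<open>H\<close> turns the composition into the product
    \<open>H * U\<close>, where \<open>U\<close> has the nonzero constant term
    \<open>deriv g 0\<close>.\<close>
  define G' where "G' = fps_shift 1 G"
  define U where "U = fps_compose G' H"
  have "G = fps_const (fps_nth G 0) + fps_X * G'"
    by (rule fps_ext) (auto simp: G'_def)
  then have "fps_compose G H = fps_const (fps_nth G 0) + H * U"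
    using H0 by (metis U_def fps_compose_add_distrib fps_compose_mult_distrib fps_const_compose fps_X_fps_compose_startby0)
  then have HU: "H * U = FA - fps_const (fps_nth G 0)" using GH by simp
  have U0: "fps_nth U 0 = deriv g 0" using G1 by (simp add: U_def G'_def)
  have "deriv g 0 \<noteq> 0"
    by (rule holomorphic_injective_imp_regular[OF gh _ ginj]) auto
  \<comment> \<open>At \<open>m = 0\<close> the constants cancel, in between the sum over the roots
    of unity is 0, and at \<open>m = n\<close> it is \<open>n\<close>, which the average divides
    out.\<close>
  have FAm: "fps_nth (FA - fps_const (fps_nth G 0)) m = (if m = n then fps_nth K n else 0)" if "m \<le> n" for m
  proof -
    consider "m = 0" | "0 < m" "m < n" | "m = n" using \<open>m \<le> n\<close> by linarith
    then show ?thesis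
    proof cases
      case 1
      have "fps_nth FA 0 = A 0" using A has_fps_expansion_imp_0_eq_fps_nth_0 by force
      moreover have "fps_nth G 0 = g 0" by (simp add: G_def fps_expansion_def)
      ultimately show ?thesis using 1 n A0 by simp
    next
      case 2
      then show ?thesis using sum_root_unity_powers[OF 2] by (simp add: FA_def w_def)
    next
      case 3
      have "w ^ n = 1" using n by (simp add: w_def Complex.DeMoivre)
      then have "(w ^ j) ^ n = 1" for j by (metis power_mult mult.commute power_one)
      then show ?thesis using 3 n by (simp add: FA_def)
    qed
  qed
  \<comment> \<open>In coefficient \<open>m\<close> of \<open>H * U\<close> only
    \<open>H_m * U_0\<close> survives the induction hypothesis. Thus \<open>H\<close> starts at
    index \<open>n\<close>, and coefficient \<open>n\<close> reads
    \<open>K_n = H_n * deriv g 0\<close>.\<close>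
  have Hm: "m < n \<Longrightarrow> fps_nth H m = 0" for m
  proof (induction m rule: less_induct)
    case (less m)
    have "(\<Sum>i\<le>m. fps_nth H i * fps_nth U (m - i)) = fps_nth H m * fps_nth U 0"
      by (subst sum.remove[of _ m]) (use less in \<open>auto intro!: sum.neutral\<close>)
    moreover have "(\<Sum>i\<le>m. fps_nth H i * fps_nth U (m - i)) = 0"
      using FAm[of m] less.prems by (simp add: fps_mult_nth atLeast0AtMost flip: HU)
    ultimately show ?case using U0 \<open>deriv g 0 \<noteq> 0\<close> by simp
  qed
  have "(\<Sum>i\<le>n. fps_nth H i * fps_nth U (n - i)) = fps_nth H n * fps_nth U 0"
    by (subst sum.remove[of _ n]) (use Hm in \<open>auto intro!: sum.neutral\<close>)
  moreover have "(\<Sum>i\<le>n. fps_nth H i * fps_nth U (n - i)) = fps_nth K n"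
    using FAm[of n] by (simp add: fps_mult_nth atLeast0AtMost flip: HU)
  ultimately have "fps_nth K n = fps_nth H n * deriv g 0" using U0 by simp
  moreover have "cmod (fps_nth H n) \<le> 1"
    unfolding H_def by (rule taylor_coeff_bounded[OF hh]) (use hD in \<open>auto intro: less_imp_le\<close>)
  ultimately show ?thesis
    using mult_right_mono[of "cmod (fps_nth H n)" 1 "cmod (deriv g 0)"]
    by (simp add: K_def norm_mult)
qed

text \<open>The mirror image of \<open>a\<close> in the imaginary axis is \<open>- cnj a\<close>, so
  a point has positive real part exactly when it is closer to \<open>a\<close> than to
  \<open>- cnj a\<close>. Hence \<open>(w - a) / (w + cnj a)\<close> is the inverse map from the
  half-plane to the disc.\<close>

lemma convex_halfplane_map:
  assumes a: "Re a > 0"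
  shows "convex_function (\<lambda>z. (a + cnj a * z) / (1 - z))"
    and "(\<lambda>z. (a + cnj a * z) / (1 - z)) ` \<D> = {w. Re w > 0}"
    and "((\<lambda>z. (a + cnj a * z) / (1 - z)) has_field_derivative 2 * Re a) (at 0)"
proof -
  let ?g = "\<lambda>z. (a + cnj a * z) / (1 - z)"
  have half: "cmod (w - a) < cmod (w + cnj a) \<longleftrightarrow> Re w > 0" for w
  proof -
    have "(cmod (w + cnj a))\<^sup>2 - (cmod (w - a))\<^sup>2 = 4 * Re a * Re w"
      by (simp add: cmod_power2) (simp add: power2_eq_square algebra_simps)
    moreover have "4 * Re a * Re w > 0 \<longleftrightarrow> Re w > 0" using a by (simp add: zero_less_mult_iff)
    moreover have "cmod (w - a) < cmod (w + cnj a) \<longleftrightarrow> (cmod (w - a))\<^sup>2 < (cmod (w + cnj a))\<^sup>2"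
      by (simp add: power_strict_mono abs_le_square_iff flip: not_le)
    ultimately show ?thesis by linarith
  qed
  have ne1: "z \<noteq> 1" if "z \<in> \<D>" for z :: complex using that by auto
  have aa: "a + cnj a = of_real (2 * Re a)" by (simp add: complex_eq_iff)
  then have aa0: "a + cnj a \<noteq> 0" using a by simp
  \<comment> \<open>Solving the equation for \<open>z\<close> once serves both injectivity and the
    computation of the image.\<close>
  have sol: "?g z = w \<longleftrightarrow> w + cnj a \<noteq> 0 \<and> z = (w - a) / (w + cnj a)" if "z \<noteq> 1" for z w
  proof -
    have "?g z = w \<longleftrightarrow> a + cnj a * z = w * (1 - z)" using that by (simp add: field_simps)
    also have "\<dots> \<longleftrightarrow> z * (w + cnj a) = w - a" by (auto simp: algebra_simps)
    also have "\<dots> \<longleftrightarrow> w + cnj a \<noteq> 0 \<and> z = (w - a) / (w + cnj a)"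
    proof (cases "w + cnj a = 0")
      case True
      then have "w - a = -(a + cnj a)" by (simp add: algebra_simps add_eq_0_iff)
      then have "w - a \<noteq> 0" using aa0 by (metis neg_equal_0_iff_equal)
      then show ?thesis using True by simp
    qed (auto simp: field_simps)
    finally show ?thesis .
  qed
  have inj: "inj_on ?g \<D>"
  proof (rule inj_onI)
    fix x y assume "x \<in> \<D>" "y \<in> \<D>" "?g x = ?g y"
    then show "x = y" using sol[of x "?g y"] sol[of y "?g y"] ne1 by auto
  qed
  show im: "?g ` \<D> = {w. Re w > 0}"
  proof safe
    fix z :: complex assume "z \<in> \<D>"
    then have "z = (?g z - a) / (?g z + cnj a)" "?g z + cnj a \<noteq> 0" using sol[of z "?g z"] ne1 by auto
    then have "cmod (?g z - a) / cmod (?g z + cnj a) < 1" using \<open>z \<in> \<D>\<close> by (metis mem_ball_0 norm_divide)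
    then show "Re (?g z) > 0" using \<open>?g z + cnj a \<noteq> 0\<close> half by (simp add: divide_less_eq)
  next
    fix w assume w: "Re w > 0"
    then have wa: "w + cnj a \<noteq> 0" using a by (auto simp: complex_eq_iff)
    define z where "z = (w - a) / (w + cnj a)"
    have zD: "z \<in> \<D>" using half[of w] w wa by (simp add: z_def norm_divide divide_less_eq)
    then have "w = ?g z" using sol[of z w] ne1[OF zD] wa z_def by simp
    then show "w \<in> ?g ` \<D>" using zD by blast
  qed
  have "convex {w. Re w > 0}" using convex_halfspace_Re_gt[of 0] by simp
  moreover have "?g holomorphic_on \<D>" using ne1 by (intro holomorphic_intros) auto
  ultimately show "convex_function ?g" using inj im by (simp add: convex_function_def)
  show "(?g has_field_derivative 2 * Re a) (at 0)"
    by (auto intro!: derivative_eq_intros simp: complex_eq_iff)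
qed

text \<open>Caratheodory's bound: \<open>q\<close> is subordinate to the half-plane map with the
  same value at 0, whose derivative there is \<open>2 * Re (q 0)\<close>.\<close>

lemma halfplane_coeff:
  assumes q: "q holomorphic_on \<D>" and re: "\<And>z. z \<in> \<D> \<Longrightarrow> Re (q z) > 0" and "n > 0"
  shows "cmod (taylor_coeff q n) \<le> 2 * Re (q 0)"
proof -
  have a: "Re (q 0) > 0" using re by simp
  have "cmod (taylor_coeff q n) \<le> cmod (deriv (\<lambda>z. (q 0 + cnj (q 0) * z) / (1 - z)) 0)"
    by (rule subordinate_convex_coeff[OF convex_halfplane_map(1)[OF a] q])
       (use re convex_halfplane_map(2)[OF a] \<open>n > 0\<close> in auto)
  then show ?thesis using DERIV_imp_deriv[OF convex_halfplane_map(3)[OF a]] a by simp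
qed

text \<open>The Schwarz lemma gives \<open>|h z| \<le> |z|\<close> for the Cayley transform
  \<open>h\<close> of \<open>q\<close>. Solving for \<open>q\<close> yields
  \<open>q (1 - h) = a + cnj a * h\<close>, and the triangle inequality bounds both sides.\<close>

lemma halfplane_lower_bound:
  assumes q: "q holomorphic_on \<D>" and re: "\<And>z. z \<in> \<D> \<Longrightarrow> Re (q z) > 0" and z: "z \<in> \<D>"
  shows "cmod (q 0) * (1 - cmod z) / (1 + cmod z) \<le> cmod (q z)"
proof -
  define a where "a = q 0"
  define h where "h = (\<lambda>z. (q z - a) / (q z + cnj a))"
  have a: "Re a > 0" using re by (simp add: a_def)
  have ne: "q z + cnj a \<noteq> 0" if "z \<in> \<D>" for z
    using re[OF that] a by (auto simp: complex_eq_iff)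
  have h1: "cmod (h z) < 1" if z: "z \<in> \<D>" for z
  proof -
    have "q z \<in> (\<lambda>z. (a + cnj a * z) / (1 - z)) ` \<D>" using convex_halfplane_map(2)[OF a] re z by auto
    then obtain x where x: "x \<in> \<D>" "q z = (a + cnj a * x) / (1 - x)" by auto
    then have "x \<noteq> 1" by auto
    then have "q z * (1 - x) = a + cnj a * x" using x by (simp add: field_simps)
    then have "x * (q z + cnj a) = q z - a" by (simp add: algebra_simps)
    then have "h z = x" using ne[OF z] by (simp add: h_def field_simps)
    then show ?thesis using x by simp
  qed
  have "h holomorphic_on \<D>" unfolding h_def using ne by (intro holomorphic_intros q) auto
  moreover have "h 0 = 0" by (simp add: h_def a_def)
  ultimately have hz: "cmod (h z) \<le> cmod z" using Schwarz_Lemma(1)[of h z] h1 z by auto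
  have "h z * (q z + cnj a) = q z - a" using ne[OF z] by (simp add: h_def)
  then have "q z * (1 - h z) = a + cnj a * h z" by (simp add: algebra_simps)
  then have "cmod (q z) * cmod (1 - h z) = cmod (a + cnj a * h z)" by (metis norm_mult)
  moreover have "cmod (a + cnj a * h z) \<ge> cmod a - cmod (cnj a * h z)" by (rule norm_diff_ineq)
  moreover have "cmod (cnj a * h z) \<le> cmod a * cmod z" using hz by (simp add: norm_mult mult_left_mono)
  moreover have "cmod (1 - h z) \<le> 1 + cmod z" using norm_triangle_ineq4[of 1 "h z"] hz by simp
  then have "cmod (q z) * cmod (1 - h z) \<le> cmod (q z) * (1 + cmod z)" by (rule mult_left_mono) simp
  ultimately have "cmod a * (1 - cmod z) \<le> cmod (q z) * (1 + cmod z)" by (simp add: algebra_simps)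
  then show ?thesis by (simp add: a_def divide_le_eq add_pos_nonneg)
qed

subsection \<open>Convex functions\<close>

text \<open>The subordination principle: the inverse of \<open>g\<close> after \<open>F\<close> is a
  self-map of the disc fixing 0, and the Schwarz lemma applies to it.\<close>

lemma convex_function_subordinate:
  assumes g: "convex_function g" and F: "F holomorphic_on \<D>" and sub: "F ` \<D> \<subseteq> g ` \<D>" and F0: "F 0 = g 0"
    and z: "z \<in> \<D>" and w: "g w = F z" "w \<in> \<D>"
  shows "cmod w \<le> cmod z"
proof -
  have gh: "g holomorphic_on \<D>" and ginj: "inj_on g \<D>"
    using g by (auto simp: convex_function_def)
  obtain gi where gi_h: "gi holomorphic_on g ` \<D>" and gi: "\<And>z. z \<in> \<D> \<Longrightarrow> gi (g z) = z"
    using disc_inverse[OF gh ginj] by blast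
  define h where "h = gi \<circ> F"
  have "h holomorphic_on \<D>"
    unfolding h_def by (rule holomorphic_on_compose_gen[OF F gi_h]) (use sub in auto)
  moreover have "h 0 = 0" using gi[of 0] by (simp add: h_def F0)
  moreover have "cmod (h x) < 1" if "cmod x < 1" for x
  proof -
    have "F x \<in> g ` \<D>" using sub that by auto
    then show ?thesis using gi by (auto simp: h_def)
  qed
  ultimately have "cmod (h z) \<le> cmod z" using z by (intro Schwarz_Lemma(1)) auto
  moreover have "h z = w" using gi[OF w(2)] w(1) by (simp add: h_def)
  ultimately show ?thesis by simp
qed

text \<open>Study's theorem. For \<open>|x| \<le> |y|\<close> the function
  \<open>u g(c z) + v g(z)\<close> with \<open>c = x / y\<close> is subordinate to \<open>g\<close>,
  so its value at \<open>y\<close>, the given convex combination, is attained by \<open>g\<close> at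
  a point of modulus at most \<open>|y|\<close>.\<close>

lemma convex_function_image_ball:
  assumes g: "convex_function g" and r: "r \<le> 1"
  shows "convex (g ` ball 0 r)"
proof -
  have gh: "g holomorphic_on \<D>" and gc: "convex (g ` \<D>)"
    using g by (auto simp: convex_function_def)
  have *: "u *\<^sub>R g x + v *\<^sub>R g y \<in> g ` ball 0 r"
    if x: "x \<in> ball 0 r" and y: "y \<in> ball 0 r" and xy: "cmod x \<le> cmod y" and uv: "0 \<le> u" "0 \<le> v" "u + v = 1" for x y u v
  proof -
    have yD: "y \<in> \<D>" and xD: "x \<in> \<D>" using x y r by auto
    \<comment> \<open>If \<open>y = 0\<close> then \<open>x = 0\<close> as well, and the default
      \<open>0 / 0 = 0\<close> still gives \<open>|c| \<le> 1\<close> and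
      \<open>c * y = x\<close>.\<close>
    define c where "c = x / y"
    have c: "cmod c \<le> 1" using xy by (auto simp: c_def norm_divide divide_le_eq_1)
    have cy: "c * y = x" using xy by (auto simp: c_def)
    define F where "F = (\<lambda>z. u *\<^sub>R g (c * z) + v *\<^sub>R g z)"
    have cD: "c * z \<in> \<D>" if "z \<in> \<D>" for z
      using mult_right_mono[OF c, of "cmod z"] that by (auto simp: norm_mult)
    have "(g \<circ> (\<lambda>z. c * z)) holomorphic_on \<D>"
      by (rule holomorphic_on_compose_gen[OF _ gh]) (use cD in \<open>auto intro!: holomorphic_intros\<close>)
    then have Fh: "F holomorphic_on \<D>"
      unfolding F_def o_def scaleR_conv_of_real by (intro holomorphic_intros gh)
    have sub: "F ` \<D> \<subseteq> g ` \<D>"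
    proof safe
      fix z :: complex assume "z \<in> \<D>"
      then show "F z \<in> g ` \<D>" unfolding F_def
        using cD by (intro convexD[OF gc]) (use uv in auto)
    qed
    have F0: "F 0 = g 0" using uv by (simp add: F_def flip: scaleR_left_distrib)
    obtain w where w: "w \<in> \<D>" "g w = F y" using sub yD by (metis image_iff image_subset_iff)
    have "cmod w \<le> cmod y" by (rule convex_function_subordinate[OF g Fh sub F0 yD w(2,1)])
    then have "w \<in> ball 0 r" using y by simp
    moreover have "F y = u *\<^sub>R g x + v *\<^sub>R g y" by (simp add: F_def cy)
    ultimately show ?thesis using w by (metis imageI)
  qed
  show ?thesis
    unfolding convex_def
  proof safe
    fix x y :: complex and u v :: real
    assume "x \<in> ball 0 r" "y \<in> ball 0 r" and uv: "0 \<le> u" "0 \<le> v" "u + v = 1"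
    then show "u *\<^sub>R g x + v *\<^sub>R g y \<in> g ` ball 0 r"
      using *[of x y u v] *[of y x v u] by (cases "cmod x \<le> cmod y") (auto simp: add.commute)
  qed
qed

text \<open>Everything rests on \<open>|1 - cnj a z|^2 - |z - a|^2 = (1 - |a|^2)(1 - |z|^2)\<close>
  and on the inverse being the same map with \<open>- a\<close> for \<open>a\<close>.\<close>

lemma disc_automorphism:
  assumes a: "cmod a < 1"
  shows "(\<lambda>z. (z - a) / (1 - cnj a * z)) ` \<D> = \<D>"
    and "inj_on (\<lambda>z. (z - a) / (1 - cnj a * z)) \<D>"
    and "z \<in> \<D> \<Longrightarrow> 1 - cnj a * z \<noteq> 0"
    and "(\<lambda>z. (z - a) / (1 - cnj a * z)) holomorphic_on \<D>"
proof -
  let ?M = "\<lambda>a z. (z - a) / (1 - cnj a * z)"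
  have ne: "1 - cnj a * z \<noteq> 0" if "cmod a < 1" "z \<in> \<D>" for a z
  proof -
    have "cmod (cnj a * z) < 1" using mult_strict_mono[of "cmod a" 1 "cmod z" 1] that by (simp add: norm_mult)
    then show ?thesis by auto
  qed
  have M: "?M a z \<in> \<D>" if "cmod a < 1" "z \<in> \<D>" for a z
  proof -
    have "(cmod (1 - cnj a * z))\<^sup>2 - (cmod (z - a))\<^sup>2 = (1 - (cmod a)\<^sup>2) * (1 - (cmod z)\<^sup>2)"
      by (simp add: cmod_power2) (simp add: power2_eq_square algebra_simps)
    moreover have "\<dots> > 0" using that by (intro mult_pos_pos) (auto simp: power_less_one_iff)
    ultimately have "(cmod (z - a))\<^sup>2 < (cmod (1 - cnj a * z))\<^sup>2" by linarith
    then have "cmod (z - a) < cmod (1 - cnj a * z)" by (rule power2_less_imp_less) simp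
    then show ?thesis using ne[OF that] by (simp add: norm_divide divide_less_eq)
  qed
  have inv: "?M (-a) (?M a z) = z" if "cmod a < 1" "z \<in> \<D>" for a z
  proof -
    have 1: "1 - cnj a * z \<noteq> 0" using ne[OF that] .
    have 2: "1 - cnj a * a \<noteq> 0" using ne[of a a] that by simp
    have "?M a z + a = z * (1 - cnj a * a) / (1 - cnj a * z)"
      using 1 by (simp add: divide_simps) (simp add: algebra_simps)
    moreover have "1 + cnj a * ?M a z = (1 - cnj a * a) / (1 - cnj a * z)"
      using 1 by (simp add: divide_simps) (simp add: algebra_simps)
    ultimately show ?thesis using 1 2 by simp
  qed
  show "?M a ` \<D> = \<D>"
  proof
    show "\<D> \<subseteq> ?M a ` \<D>"
    proof
      fix z :: complex assume z: "z \<in> \<D>"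
      define x where "x = ?M (-a) z"
      have "?M a x = z" "x \<in> \<D>" using inv[of "-a" z] M[of "-a" z] a z by (simp_all add: x_def)
      then show "z \<in> ?M a ` \<D>" by (intro image_eqI[where x = x]) simp_all
    qed
  qed (use M[OF a] in blast)
  show "inj_on (?M a) \<D>" using inv[OF a] by (intro inj_on_inverseI[of _ "?M (-a)"]) auto
  show "z \<in> \<D> \<Longrightarrow> 1 - cnj a * z \<noteq> 0" using ne[OF a] .
  show "?M a holomorphic_on \<D>" using ne[OF a] by (intro holomorphic_intros) auto
qed

lemma convex_function_automorphism:
  assumes g: "convex_function g" and a: "cmod a < 1"
  shows "convex_function (\<lambda>z. g ((z - a) / (1 - cnj a * z)))"
proof -
  note M = disc_automorphism[OF a]
  have "inj_on (g \<circ> (\<lambda>z. (z - a) / (1 - cnj a * z))) \<D>"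
    using M(1,2) g by (intro comp_inj_on) (auto simp: convex_function_def)
  moreover have "(g \<circ> (\<lambda>z. (z - a) / (1 - cnj a * z))) holomorphic_on \<D>"
    using M g by (intro holomorphic_on_compose_gen[of _ _ g "\<D>"]) (auto simp: convex_function_def)
  moreover have "(g \<circ> (\<lambda>z. (z - a) / (1 - cnj a * z))) ` \<D> = g ` \<D>"
    using M(1) by (metis image_comp)
  ultimately show ?thesis using g by (simp add: convex_function_def o_def)
qed

text \<open>Since the image is star-shaped about 0, subordination says that the preimage of
  \<open>(1 - t) g z\<close> has modulus at most \<open>|z|\<close>; a negative real part would let
  this preimage start outwards. With \<open>cnj z\<close> in place of \<open>1 / z\<close>, the
  usual condition on \<open>z g' / g\<close> is inverted and makes sense at 0.\<close>

lemma starlike_of_convex: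
  assumes g: "convex_function g" and g0: "g 0 = 0" and z: "z \<in> \<D>"
  shows "Re (cnj z * (g z / deriv g z)) \<ge> 0"
proof (rule ccontr)
  assume "\<not> ?thesis"
  then have neg: "Re (cnj z * (- g z / deriv g z)) > 0" by simp
  have gh: "g holomorphic_on \<D>" and ginj: "inj_on g \<D>" and gc: "convex (g ` \<D>)"
    using g by (auto simp: convex_function_def)
  obtain gi where gi_h: "gi holomorphic_on g ` \<D>"
    and gi: "\<And>z. z \<in> \<D> \<Longrightarrow> gi (g z) = z"
    and gi': "\<And>z. z \<in> \<D> \<Longrightarrow> deriv g z * deriv gi (g z) = 1"
    using disc_inverse[OF gh ginj] by blast
  have op: "open (g ` \<D>)" by (rule open_mapping_thm3[OF gh _ ginj]) auto
  have "(gi has_field_derivative deriv gi (g z)) (at (g z))"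
    using holomorphic_derivI[OF gi_h op] z by auto
  then have "((\<lambda>s. cnj z * gi ((1 - s) * g z)) has_field_derivative cnj z * (deriv gi (g z) * (- g z))) (at (of_real 0))"
    by (auto intro!: derivative_eq_intros DERIV_chain2[of gi])
  moreover have "deriv gi (g z) = 1 / deriv g z"
    using gi'[OF z] by (metis mult.commute mult_zero_left nonzero_eq_divide_eq zero_neq_one)
  ultimately have "((\<lambda>s. cnj z * gi ((1 - s) * g z)) has_field_derivative cnj z * (- g z / deriv g z)) (at (of_real 0))"
    by simp
  from has_field_derivative_Re[OF has_vector_derivative_real_field[OF this]]
  have "((\<lambda>t. Re (cnj z * gi ((1 - of_real t) * g z))) has_field_derivative Re (cnj z * (- g z / deriv g z))) (at 0)" .
  from DERIV_pos_inc_right[OF this neg] obtain d where d: "d > 0"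
    and inc: "\<And>h. 0 < h \<Longrightarrow> h < d \<Longrightarrow> Re (cnj z * gi (g z)) < Re (cnj z * gi ((1 - of_real h) * g z))"
    by auto
  \<comment> \<open>The cap at 1 makes \<open>(1 - t) * g x\<close> a convex combination of
    \<open>g x\<close> and \<open>g 0 = 0\<close>.\<close>
  define t where "t = min (d / 2) 1"
  have t: "0 < t" "t < d" "t \<le> 1" using d by (auto simp: t_def)
  have sub: "(1 - of_real t) * g x \<in> g ` \<D>" if "x \<in> \<D>" for x
  proof -
    have "(1 - t) *\<^sub>R g x + t *\<^sub>R g 0 \<in> g ` \<D>"
      by (rule convexD[OF gc]) (use t that in auto)
    then show ?thesis by (simp add: g0 scaleR_conv_of_real)
  qed
  obtain w where w: "w \<in> \<D>" "g w = (1 - of_real t) * g z" using sub[OF z] by (metis imageE)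
  have "cmod w \<le> cmod z"
    by (rule convex_function_subordinate[OF g _ _ _ z, where F = "\<lambda>x. (1 - of_real t) * g x"])
       (use sub w g0 in \<open>auto intro!: holomorphic_intros gh\<close>)
  have "Re (cnj z * z) < Re (cnj z * w)"
    using inc[OF t(1,2)] gi[OF z] gi[OF w(1)] by (simp flip: w(2))
  also have "\<dots> \<le> cmod (cnj z * w)" by (rule complex_Re_le_cmod)
  also have "\<dots> \<le> cmod z * cmod z" using \<open>cmod w \<le> cmod z\<close> by (simp add: norm_mult mult_left_mono)
  also have "\<dots> = Re (cnj z * z)" by (simp add: cmod_power2 flip: power2_eq_square)
  finally show False by simp
qed

text \<open>A boundary point of the convex image of the disc with diameter \<open>[- (\<rho> + a) / (1 + a \<rho>), r]\<close>
  has a supporting half-plane; the limit \<open>\<rho> \<longlonglongrightarrow> 1\<close>, in which the disc becomes a horodisc, gives the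
  sharp constant.\<close>

lemma convex_function_lower_growth_real:
  assumes g: "convex_function g" and g0: "g 0 = 0" and r: "0 < r" "r < 1"
  shows "cmod (deriv g 0) * r / (1 + r) \<le> cmod (g (of_real r))"
proof -
  have gh: "g holomorphic_on \<D>" using g by (auto simp: convex_function_def)
  have main: "cmod (deriv g 0) * (r * (2 * \<rho> - r * (1 + \<rho>\<^sup>2)) / (\<rho> * (1 - r\<^sup>2))) \<le> 2 * cmod (g (of_real r))"
    if \<rho>: "r < \<rho>" "\<rho> < 1" for \<rho> :: real
  proof -
    have rr: "r * \<rho> < 1" using mult_strict_mono[of r 1 \<rho> 1] r \<rho> by simp
    \<comment> \<open>With this \<open>a\<close> the automorphism in \<open>G\<close> sends
      \<open>\<rho>\<close> to \<open>r\<close> and \<open>a\<close> to 0. The boundary point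
      \<open>\<rho>\<close> of \<open>ball 0 \<rho>\<close> thus carries the value
      \<open>g r\<close>.\<close>
    define a where "a = (\<rho> - r) / (1 - r * \<rho>)"
    have a0: "0 < a" using \<rho> rr by (simp add: a_def)
    have "\<rho> - a = r * (1 - \<rho>\<^sup>2) / (1 - r * \<rho>)"
      using rr by (simp add: a_def field_simps power2_eq_square)
    moreover have "\<dots> > 0" using rr r \<rho> by (simp add: power_less_one_iff)
    ultimately have a\<rho>: "a < \<rho>" by linarith
    have a1: "cmod (of_real a) < 1" using a0 a\<rho> \<rho> by simp
    define G where "G = (\<lambda>z. g ((z - of_real a) / (1 - of_real a * z)))"
    have G: "convex_function G"
      using convex_function_automorphism[OF g a1] by (simp add: G_def)
    then have Gh: "G holomorphic_on \<D>" and Ginj: "inj_on G \<D>" by (auto simp: convex_function_def)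
    have Ga: "G (of_real a) = 0" by (simp add: G_def g0)
    have "(\<rho> - a) / (1 - a * \<rho>) = r"
    proof -
      have "1 - a * \<rho> = (1 - \<rho>\<^sup>2) / (1 - r * \<rho>)"
        using rr by (simp add: a_def field_simps power2_eq_square)
      then show ?thesis using \<open>\<rho> - a = _\<close> rr r \<rho> by (simp add: power2_eq_1_iff)
    qed
    then have "(of_real \<rho> - of_real a) / (1 - of_real a * of_real \<rho>) = (of_real r :: complex)"
      by (metis of_real_1 of_real_diff of_real_divide of_real_mult)
    then have G\<rho>: "G (of_real \<rho>) = g (of_real r)" by (simp add: G_def)
    define S where "S = G ` ball 0 \<rho>"
    have S: "convex S" unfolding S_def by (rule convex_function_image_ball[OF G]) (use \<rho> in simp)
    have aS: "complex_of_real a \<in> ball 0 \<rho>" using a0 a\<rho> by simp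
    have "g (of_real r) \<notin> S"
    proof
      assume "g (of_real r) \<in> S"
      then obtain x where "x \<in> ball 0 \<rho>" "G x = G (of_real \<rho>)" by (auto simp: S_def G\<rho>)
      then show False using inj_onD[OF Ginj, of x "of_real \<rho>"] \<rho> r by auto
    qed
    then have "\<exists>u b. u \<noteq> 0 \<and> (\<forall>x\<in>S. inner u x \<le> b) \<and> (\<forall>x\<in>{g (of_real r)}. inner u x \<ge> b)"
      using S aS by (intro separating_hyperplane_sets) (auto simp: S_def)
    then obtain u where u: "u \<noteq> 0" "\<And>x. x \<in> S \<Longrightarrow> inner u x \<le> inner u (g (of_real r))"
      by (metis order_trans singletonI)
    \<comment> \<open>Rescaled position of \<open>a\<close> in \<open>ball 0 \<rho>\<close>: the map
      \<open>N\<close> takes the unit disc into that ball with \<open>N 0 = a\<close>, so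
      \<open>F\<close> below vanishes at 0 and has values in \<open>S\<close>.\<close>
    define b where "b = a / \<rho>"
    have b: "0 < b" "b < 1" using a0 a\<rho> \<rho> r by (auto simp: b_def)
    have b1: "cmod (of_real (-b)) < 1" using b by simp
    note M = disc_automorphism[OF b1]
    define N where "N = (\<lambda>z. of_real \<rho> * ((z - of_real (-b)) / (1 - cnj (of_real (-b)) * z)))"
    have N: "N z \<in> ball 0 \<rho>" if "z \<in> \<D>" for z
    proof -
      define y where "y = (z - of_real (-b)) / (1 - cnj (of_real (-b)) * z)"
      have "y \<in> \<D>" unfolding y_def using M(1) that by blast
      moreover have "N z = of_real \<rho> * y" by (simp add: N_def y_def)
      ultimately show ?thesis using \<rho> r by (simp add: norm_mult)
    qed
    have Nh: "N holomorphic_on \<D>" unfolding N_def by (intro holomorphic_intros M)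
    have N0: "N 0 = of_real a" using r \<rho> by (simp add: N_def b_def)
    define F where "F = (\<lambda>z. G (N z))"
    have Fh: "F holomorphic_on \<D>"
    proof -
      have "G \<circ> N holomorphic_on \<D>"
        by (rule holomorphic_on_compose_gen[OF Nh Gh]) (use N \<rho> in force)
      then show ?thesis by (simp add: F_def o_def)
    qed
    have FS: "F z \<in> S" if "z \<in> \<D>" for z using N[OF that] by (auto simp: F_def S_def)
    have F0: "F 0 = 0" by (simp add: F_def N0 Ga)
    have 1: "cmod u * cmod (deriv F 0) \<le> 2 * inner u (g (of_real r)) + e" if e: "e > 0" for e
    proof -
      \<comment> \<open>The support condition gives only a nonnegative real part; the extra
        \<open>e / 2\<close> makes it positive, and the bound on the first coefficient doubles it to
        \<open>e\<close>.\<close>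
      define q where "q = (\<lambda>z. of_real (inner u (g (of_real r)) + e / 2) - cnj u * F z)"
      have qh: "q holomorphic_on \<D>" unfolding q_def by (intro holomorphic_intros Fh)
      have "Re (q z) > 0" if "z \<in> \<D>" for z
        using u(2)[OF FS[OF that]] e by (simp add: q_def inner_complex_def)
      from halfplane_coeff[OF qh this, of 1]
      have "cmod (deriv q 0) \<le> 2 * Re (q 0)" by (simp add: fps_expansion_def)
      moreover have "deriv q 0 = - (cnj u * deriv F 0)"
        unfolding q_def using holomorphic_derivI[OF Fh, of 0]
        by (intro DERIV_imp_deriv) (auto intro!: derivative_eq_intros)
      ultimately show ?thesis by (simp add: norm_mult q_def F0 algebra_simps)
    qed
    have "cmod u * cmod (deriv F 0) \<le> 2 * inner u (g (of_real r))"
      by (rule field_le_epsilon) (use 1 in auto)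
    also have "\<dots> \<le> 2 * (cmod u * cmod (g (of_real r)))"
      using norm_cauchy_schwarz[of u "g (of_real r)"] by simp
    finally have "cmod (deriv F 0) \<le> 2 * cmod (g (of_real r))" using u(1) by simp
    \<comment> \<open>The chain rule gives the factor \<open>\<rho> (1 - b^2) / (1 - a^2)\<close>,
      which is \<open>0 / 0\<close> in the limit because \<open>a\<close> and \<open>b\<close> tend
      to 1. Cancelling \<open>1 - \<rho>^2\<close> leaves a form that is continuous at
      \<open>\<rho> = 1\<close>.\<close>
    moreover have "deriv F 0 = deriv g 0 * of_real (r * (2 * \<rho> - r * (1 + \<rho>\<^sup>2)) / (\<rho> * (1 - r\<^sup>2)))"
    proof -
      have a2: "1 - a\<^sup>2 > 0" using a0 a1 by (simp add: power_less_one_iff)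
      then have a2c: "1 - (complex_of_real a)\<^sup>2 \<noteq> 0"
        by (metis of_real_1 of_real_diff of_real_eq_0_iff of_real_power less_irrefl)
      have dg: "(g has_field_derivative deriv g 0) (at ((of_real a - of_real a) / (1 - of_real a * of_real a)))"
        using holomorphic_derivI[OF gh, of 0] by simp
      have dM: "((\<lambda>z. (z - of_real a) / (1 - of_real a * z)) has_field_derivative 1 / (1 - (of_real a)\<^sup>2)) (at (complex_of_real a))"
        using a2c by (auto intro!: derivative_eq_intros simp: power2_eq_square)
      have dG: "(G has_field_derivative deriv g 0 * (1 / (1 - (of_real a)\<^sup>2))) (at (N 0))"
        unfolding G_def N0 by (rule DERIV_chain2[OF dg dM])
      have dN: "(N has_field_derivative of_real (\<rho> * (1 - b\<^sup>2))) (at 0)"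
        unfolding N_def by (auto intro!: derivative_eq_intros simp: power2_eq_square field_simps)
      have "(F has_field_derivative deriv g 0 * (1 / (1 - (of_real a)\<^sup>2)) * of_real (\<rho> * (1 - b\<^sup>2))) (at 0)"
        unfolding F_def by (rule DERIV_chain2[OF dG dN])
      then have "deriv F 0 = deriv g 0 * of_real (\<rho> * (1 - b\<^sup>2) / (1 - a\<^sup>2))"
        by (simp add: DERIV_imp_deriv)
      also have "\<rho> * (1 - b\<^sup>2) / (1 - a\<^sup>2) = r * (2 * \<rho> - r * (1 + \<rho>\<^sup>2)) / (\<rho> * (1 - r\<^sup>2))"
      proof -
        have p: "1 - \<rho>\<^sup>2 > 0" "1 - r\<^sup>2 > 0" using r \<rho> by (auto simp: power_less_one_iff)
        have e1: "1 - a\<^sup>2 = (1 - \<rho>\<^sup>2) * (1 - r\<^sup>2) / (1 - r * \<rho>)\<^sup>2"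
          using rr by (simp add: a_def power_divide field_simps) (simp add: power2_eq_square algebra_simps)
        have "\<rho>\<^sup>2 - a\<^sup>2 = r * (1 - \<rho>\<^sup>2) * (2 * \<rho> - r * (1 + \<rho>\<^sup>2)) / (1 - r * \<rho>)\<^sup>2"
        proof -
          have ad: "a * (1 - r * \<rho>) = \<rho> - r" using rr by (simp add: a_def)
          have "(\<rho>\<^sup>2 - a\<^sup>2) * (1 - r * \<rho>)\<^sup>2 = \<rho>\<^sup>2 * (1 - r * \<rho>)\<^sup>2 - (a * (1 - r * \<rho>))\<^sup>2"
            by (simp add: power_mult_distrib left_diff_distrib)
          also have "\<dots> = r * (1 - \<rho>\<^sup>2) * (2 * \<rho> - r * (1 + \<rho>\<^sup>2))"
            unfolding ad by (simp add: power2_eq_square algebra_simps)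
          finally show ?thesis using rr by (simp add: nonzero_eq_divide_eq)
        qed
        moreover have "\<rho> * (1 - b\<^sup>2) = (\<rho>\<^sup>2 - a\<^sup>2) / \<rho>"
          using r \<rho> by (simp add: b_def right_diff_distrib diff_divide_distrib power2_eq_square)
        ultimately have e2: "\<rho> * (1 - b\<^sup>2) = r * (1 - \<rho>\<^sup>2) * (2 * \<rho> - r * (1 + \<rho>\<^sup>2)) / (1 - r * \<rho>)\<^sup>2 / \<rho>"
          by simp
        show ?thesis unfolding e1 e2 using p rr r \<rho> by simp
      qed
      finally show ?thesis .
    qed
    moreover have "0 \<le> r * (2 * \<rho> - r * (1 + \<rho>\<^sup>2)) / (\<rho> * (1 - r\<^sup>2))"
    proof -
      have "r * (1 + \<rho>\<^sup>2) \<le> \<rho> * (1 + \<rho>\<^sup>2)" using \<rho> by (intro mult_right_mono) auto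
      also have "\<dots> \<le> \<rho> * 2" using \<rho> r by (intro mult_left_mono) (auto simp: power_le_one_iff)
      finally show ?thesis using r \<rho> by (intro divide_nonneg_pos mult_nonneg_nonneg mult_pos_pos) (auto simp: power_less_one_iff)
    qed
    ultimately show ?thesis by (metis abs_of_nonneg norm_mult norm_of_real)
  qed
  have ev: "eventually (\<lambda>\<rho>. cmod (deriv g 0) * (r * (2 * \<rho> - r * (1 + \<rho>\<^sup>2)) / (\<rho> * (1 - r\<^sup>2))) \<le> 2 * cmod (g (of_real r))) (at_left 1)"
    unfolding eventually_at_left_field using main r by (intro exI[of _ r]) auto
  have r2: "1 - r\<^sup>2 > 0" using r by (simp add: power_less_one_iff)
  have "((\<lambda>\<rho>. cmod (deriv g 0) * (r * (2 * \<rho> - r * (1 + \<rho>\<^sup>2)) / (\<rho> * (1 - r\<^sup>2)))) \<longlongrightarrow>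
      cmod (deriv g 0) * (r * (2 * 1 - r * (1 + 1\<^sup>2)) / (1 * (1 - r\<^sup>2)))) (at_left 1)"
    using r2 by (intro tendsto_intros) auto
  from tendsto_upperbound[OF this ev]
  have "cmod (deriv g 0) * (r * (2 * 1 - r * (1 + 1\<^sup>2)) / (1 * (1 - r\<^sup>2))) \<le> 2 * cmod (g (of_real r))" by simp
  \<comment> \<open>The factor 2 of the limit cancels the one from the half-plane coefficient bound,
    which makes the constant sharp.\<close>
  moreover have "r * (2 * 1 - r * (1 + 1\<^sup>2)) / (1 * (1 - r\<^sup>2)) = 2 * (r / (1 + r))"
  proof -
    have "1 - r\<^sup>2 = (1 - r) * (1 + r)" "r * (2 * 1 - r * (1 + 1\<^sup>2)) = 2 * r * (1 - r)"
      by (simp_all add: power2_eq_square algebra_simps)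
    then have "r * (2 * 1 - r * (1 + 1\<^sup>2)) / (1 * (1 - r\<^sup>2)) = 2 * r * (1 - r) / ((1 - r) * (1 + r))"
      by (simp only: mult_1)
    also have "\<dots> = 2 * (r / (1 + r))" using r by simp
    finally show ?thesis .
  qed
  ultimately have "cmod (deriv g 0) * (2 * (r / (1 + r))) \<le> 2 * cmod (g (of_real r))" by (simp only:)
  moreover have "cmod (deriv g 0) * (2 * (r / (1 + r))) = 2 * (cmod (deriv g 0) * r / (1 + r))" by simp
  ultimately show ?thesis by linarith
qed

text \<open>Precomposing with the rotation by the direction \<open>e\<close> of \<open>z\<close>
  reduces to a point of the positive real axis.\<close>

lemma convex_function_lower_growth:
  assumes g: "convex_function g" and g0: "g 0 = 0" and z: "z \<in> \<D>"
  shows "cmod (deriv g 0) * cmod z / (1 + cmod z) \<le> cmod (g z)"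
proof (cases "z = 0")
  case False
  define e where "e = z / of_real (cmod z)"
  have e: "cmod e = 1" "e \<noteq> 0" "e * of_real (cmod z) = z" using False by (auto simp: e_def norm_divide)
  have gh: "g holomorphic_on \<D>" using g by (auto simp: convex_function_def)
  define h where "h = g \<circ> (\<lambda>x. e * x)"
  have im: "(\<lambda>x. e * x) ` \<D> = \<D>"
  proof
    show "\<D> \<subseteq> (\<lambda>x. e * x) ` \<D>"
    proof
      fix x :: complex assume "x \<in> \<D>"
      then have "x = e * (x / e)" "x / e \<in> \<D>" using e by (auto simp: norm_divide)
      then show "x \<in> (\<lambda>x. e * x) ` \<D>" by blast
    qed
  qed (use e in \<open>auto simp: norm_mult\<close>)
  have "h holomorphic_on \<D>"
    unfolding h_def by (rule holomorphic_on_compose_gen[OF _ gh]) (use im in \<open>auto intro!: holomorphic_intros\<close>)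
  moreover have "inj_on h \<D>"
    unfolding h_def by (rule comp_inj_on) (use im g e in \<open>auto simp: convex_function_def inj_on_def\<close>)
  moreover have "h ` \<D> = g ` \<D>" unfolding h_def using im by (metis image_comp)
  ultimately have h: "convex_function h" using g by (simp add: convex_function_def)
  have "(g has_field_derivative deriv g 0) (at (e * 0))" using holomorphic_derivI[OF gh, of 0] by simp
  then have "(h has_field_derivative deriv g 0 * e) (at 0)"
    unfolding h_def o_def by (rule DERIV_chain2) (auto intro!: derivative_eq_intros)
  then have "deriv h 0 = deriv g 0 * e" by (rule DERIV_imp_deriv)
  moreover have "h 0 = 0" by (simp add: h_def g0)
  moreover have "h (of_real (cmod z)) = g z" by (simp add: h_def e)
  ultimately show ?thesis
    using convex_function_lower_growth_real[OF h, of "cmod z"] False z by (simp add: norm_mult e)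
qed auto

subsection \<open>Covering and univalence\<close>

text \<open>If \<open>f\<close> missed a value \<open>w\<close> with \<open>|w| < m r\<close>, then \<open>|f z - w| + k m |z|\<close> would have a minimum
  on the closed disc of radius \<open>r\<close> for every \<open>k < 1\<close>; but moving \<open>z\<close> so that \<open>f z\<close> heads for \<open>w\<close> makes
  the first term fall faster than the second one grows.\<close>

lemma covering_of_deriv_lower_bound:
  fixes m m' :: "real \<Rightarrow> real"
  assumes f: "f holomorphic_on \<D>" and f0: "f 0 = 0" and m0: "m 0 = 0"
    and m: "\<And>s. 0 \<le> s \<Longrightarrow> s < 1 \<Longrightarrow> (m has_real_derivative m' s) (at s)"
    and m'_pos: "\<And>s. 0 \<le> s \<Longrightarrow> s < 1 \<Longrightarrow> m' s > 0"
    and f': "\<And>z. z \<in> \<D> \<Longrightarrow> m' (cmod z) \<le> cmod (deriv f z)"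
    and r: "0 < r" "r < 1" and w: "cmod w < m r"
  shows "w \<in> f ` \<D>"
proof -
  have mono: "m s \<le> m t" if "0 \<le> s" "s \<le> t" "t < 1" for s t
    by (rule DERIV_nonneg_imp_nondecreasing[OF that(2)]) (use that m m'_pos in \<open>meson less_imp_le order_le_less_trans order_trans\<close>)
  have mr: "m r > 0" using w norm_ge_zero[of w] by linarith
  define x where "x = cmod w / m r"
  \<comment> \<open>The midpoint between \<open>|w| / m r\<close> and 1: \<open>k * m r\<close>
    still exceeds \<open>|w|\<close>, and \<open>k < 1\<close> makes the descent below
    strict.\<close>
  define k where "k = (x + 1) / 2"
  have "x < 1" "0 \<le> x" using w mr by (simp_all add: x_def)
  then have k: "0 < k" "k < 1" "x < k" unfolding k_def by simp_all
  then have kw: "cmod w < k * m r" using mr by (simp add: x_def divide_less_eq)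
  define \<phi> where "\<phi> = (\<lambda>z. cmod (f z - w) + k * m (cmod z))"
  have "continuous_on (cball 0 r) \<phi>"
  proof -
    have "continuous_on {0..r} m"
      using r by (intro continuous_at_imp_continuous_on ballI DERIV_isCont[OF m]) auto
    then have "continuous_on (cball 0 r) (m \<circ> cmod)"
      by (intro continuous_on_compose) (auto intro!: continuous_intros elim!: continuous_on_subset)
    moreover have "continuous_on (cball 0 r) f"
      using holomorphic_on_imp_continuous_on[OF f] r by (auto elim!: continuous_on_subset)
    ultimately show ?thesis unfolding \<phi>_def o_def by (intro continuous_intros)
  qed
  then obtain z where z: "z \<in> cball 0 r" and min: "\<And>y. y \<in> cball 0 r \<Longrightarrow> \<phi> z \<le> \<phi> y"
    using continuous_attains_inf[of "cball (0::complex) r" \<phi>] r by auto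
  have "\<phi> z \<le> cmod w" using min[of 0] r by (simp add: \<phi>_def f0 m0)
  then have "k * m (cmod z) < k * m r" using kw norm_ge_zero[of "f z - w"] unfolding \<phi>_def by linarith
  then have "cmod z \<noteq> r" by auto
  then have zr: "cmod z < r" using z by auto
  have zD: "z \<in> \<D>" using zr r by simp
  show ?thesis
  proof (cases "f z = w")
    case False
    have d0: "deriv f z \<noteq> 0" using f'[OF zD] m'_pos[of "cmod z"] zD by auto
    \<comment> \<open>In this direction \<open>f\<close> moves straight towards \<open>w\<close>, so
      \<open>|f - w|\<close> falls at the rate \<open>|deriv f z| |v|\<close>.\<close>
    define v where "v = (w - f z) / deriv f z"
    define A where "A = (\<lambda>t::real. cmod (f (z + of_real t * v) - w))"
    \<comment> \<open>Replacing \<open>|z + t v|\<close> by its bound \<open>|z| + t |v|\<close>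
      gives a majorant of \<open>\<phi>\<close> along the ray that is differentiable at
      \<open>t = 0\<close> even for \<open>z = 0\<close>.\<close>
    define \<psi> where "\<psi> = (\<lambda>t. A t + k * m (cmod z + t * cmod v))"
    have "(f has_field_derivative deriv f z) (at (z + of_real 0 * v))"
      using holomorphic_derivI[OF f _ zD] by simp
    then have "((\<lambda>s. f (z + s * v) - w) has_field_derivative deriv f z * v) (at (of_real 0))"
      by (auto intro!: derivative_eq_intros DERIV_chain2[of f])
    moreover have "deriv f z * v = w - f z" using d0 by (simp add: v_def)
    ultimately have "((\<lambda>s. f (z + s * v) - w) has_field_derivative (w - f z)) (at (of_real 0))" by simp
    then have dv: "((\<lambda>t. f (z + of_real t * v) - w) has_vector_derivative (w - f z)) (at 0)"
      using has_vector_derivative_real_field by fastforce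
    have "((\<lambda>t. norm (f (z + of_real t * v) - w)) has_derivative
        (\<lambda>h. (h *\<^sub>R (w - f z)) \<bullet> sgn (f (z + of_real 0 * v) - w))) (at 0)"
      using False by (intro has_derivative_compose[OF dv[unfolded has_vector_derivative_def] has_derivative_norm]) auto
    moreover have "(h *\<^sub>R (w - f z)) \<bullet> sgn (f (z + of_real 0 * v) - w) = - cmod (w - f z) * h" for h
    proof -
      have "(w - f z) \<bullet> sgn (f z - w) = - ((w - f z) \<bullet> sgn (w - f z))"
        by (metis inner_minus_right minus_diff_eq sgn_minus)
      also have "(w - f z) \<bullet> sgn (w - f z) = cmod (w - f z)"
        using False by (simp add: sgn_div_norm dot_square_norm power2_eq_square)
      finally show ?thesis by simp
    qed
    then have "(\<lambda>h. (h *\<^sub>R (w - f z)) \<bullet> sgn (f (z + of_real 0 * v) - w)) = (*) (- cmod (w - f z))"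
      by (rule ext)
    ultimately have dA: "(A has_real_derivative - cmod (w - f z)) (at 0)"
      unfolding A_def has_field_derivative_def by (simp only:)
    have dm: "((\<lambda>t. m (cmod z + t * cmod v)) has_real_derivative m' (cmod z) * cmod v) (at 0)"
      by (rule DERIV_chain2[of m]) (use m[of "cmod z"] zD in \<open>auto intro!: derivative_eq_intros\<close>)
    have d\<psi>: "(\<psi> has_real_derivative (- cmod (w - f z) + k * (m' (cmod z) * cmod v))) (at 0)"
      unfolding \<psi>_def by (rule DERIV_add[OF dA DERIV_cmult[OF dm]])
    have "cmod v > 0" using False d0 by (simp add: v_def)
    have "k * (m' (cmod z) * cmod v) < m' (cmod z) * cmod v"
      using k \<open>cmod v > 0\<close> m'_pos[of "cmod z"] zD by simp
    also have "\<dots> \<le> cmod (deriv f z) * cmod v" using f'[OF zD] by (simp add: mult_right_mono)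
    also have "\<dots> = cmod (w - f z)" using d0 by (simp add: v_def norm_divide)
    finally have "- cmod (w - f z) + k * (m' (cmod z) * cmod v) < 0" by simp
    from DERIV_neg_dec_right[OF d\<psi> this] obtain d where d: "d > 0"
      and dec: "\<And>h. 0 < h \<Longrightarrow> h < d \<Longrightarrow> \<psi> h < \<psi> 0" by auto
    define t where "t = min (d / 2) ((r - cmod z) / cmod v)"
    have t: "0 < t" "t < d" "t * cmod v \<le> r - cmod z"
      using d zr \<open>cmod v > 0\<close> by (auto simp: t_def min_def field_simps)
    have tz: "cmod (z + of_real t * v) \<le> cmod z + t * cmod v"
      using norm_triangle_ineq[of z "of_real t * v"] t by (simp add: norm_mult)
    have "z + of_real t * v \<in> cball 0 r" using tz t by simp
    from min[OF this] have "\<phi> z \<le> \<phi> (z + of_real t * v)" .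
    also have "\<dots> \<le> \<psi> t"
      using mono[OF _ tz] t r k by (simp add: \<phi>_def \<psi>_def A_def)
    also have "\<dots> < \<psi> 0" using dec t by simp
    also have "\<psi> 0 = \<phi> z" by (simp add: \<psi>_def \<phi>_def A_def)
    finally show ?thesis by simp
  qed (use zD in blast)
qed

section \<open>Univalence by a homotopy to a starlike function\<close>

lemma Re_of_real_mult: "Re (of_real a * z) = a * Re z"
  by simp

lemma Re_inverse_eq: "Re (inverse z) = Re z / (cmod z)\<^sup>2"
  by (simp add: cmod_power2)

lemma Re_inverse_pos_iff: "Re (inverse z) > 0 \<longleftrightarrow> Re z > 0"
  unfolding Re_inverse_eq by (cases "z = 0") (simp_all add: zero_less_divide_iff)

lemma Re_inverse_nonneg_iff: "Re (inverse z) \<ge> 0 \<longleftrightarrow> Re z \<ge> 0"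
  unfolding Re_inverse_eq by (cases "z = 0") (simp_all add: zero_le_divide_iff)

text \<open>Close-to-convexity in Kaplan's sense: \<open>z f' = q g\<close> with \<open>g\<close>
  starlike. The relation at 0 is fixed separately because this equation is void there.\<close>

locale close_to_starlike =
  fixes f g q :: "complex \<Rightarrow> complex"
  assumes f: "f holomorphic_on \<D>" and g: "g holomorphic_on \<D>"
    and g0: "g 0 = 0" and g_inj: "inj_on g \<D>"
    and star: "\<And>z. z \<in> \<D> \<Longrightarrow> Re (cnj z * (g z / deriv g z)) \<ge> 0"
    and q: "\<And>z. z \<in> \<D> \<Longrightarrow> Re (q z) > 0"
    and f': "\<And>z. z \<in> \<D> \<Longrightarrow> z * deriv f z = q z * g z"
    and f'0: "deriv f 0 = q 0 * deriv g 0"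
begin

lemma g_nz: "z \<in> \<D> \<Longrightarrow> z \<noteq> 0 \<Longrightarrow> g z \<noteq> 0"
  using g_inj g0 by (auto simp: inj_on_def dest: bspec[where x = 0])

lemma g'_nz: "z \<in> \<D> \<Longrightarrow> deriv g z \<noteq> 0"
  by (rule holomorphic_injective_imp_regular[OF g _ g_inj]) auto

lemma Re_star: "z \<in> \<D> \<Longrightarrow> z \<noteq> 0 \<Longrightarrow> Re (z * deriv g z / g z) \<ge> 0"
proof -
  assume z: "z \<in> \<D>" "z \<noteq> 0"
  have "cnj z * (g z / deriv g z) = of_real ((cmod z)\<^sup>2) * inverse (z * deriv g z / g z)"
    using z g'_nz g_nz by (simp add: field_simps complex_norm_square[symmetric] del: of_real_power)
  then have "(cmod z)\<^sup>2 * Re (inverse (z * deriv g z / g z)) \<ge> 0"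
    using star[OF z(1)] by (simp only: Re_complex_of_real Re_of_real_mult)
  then have "Re (inverse (z * deriv g z / g z)) \<ge> 0" using z by (simp add: zero_le_mult_iff)
  then show ?thesis by (simp only: Re_inverse_nonneg_iff)
qed

text \<open>The factor is \<open>a q + b z g' / g\<close>, where the first summand has positive real
  part and the second a nonnegative one.\<close>

lemma combination_factor:
  assumes z: "z \<in> \<D>" "z \<noteq> 0" and ab: "a > 0" "b \<ge> (0::real)"
  obtains k where "Re k > 0" "z * (of_real a * deriv f z + of_real b * deriv g z) = g z * k"
proof
  let ?k = "of_real a * q z + of_real b * (z * deriv g z / g z)"
  have "Re ?k = a * Re (q z) + b * Re (z * deriv g z / g z)" by (simp only: plus_complex.sel Re_of_real_mult)
  moreover have "a * Re (q z) > 0" using q[OF z(1)] ab by simp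
  moreover have "b * Re (z * deriv g z / g z) \<ge> 0" using Re_star[OF z] ab by (intro mult_nonneg_nonneg)
  ultimately show "Re ?k > 0" by linarith
  have "z * (of_real a * deriv f z + of_real b * deriv g z) = of_real a * (z * deriv f z) + of_real b * (z * deriv g z)"
    by (simp add: algebra_simps)
  then show "z * (of_real a * deriv f z + of_real b * deriv g z) = g z * ?k"
    using f'[OF z(1)] g_nz[OF z] by (simp add: field_simps)
qed

text \<open>Local univalence along the whole homotopy from \<open>g\<close> to \<open>f\<close>.
  Away from 0 it comes from the factor of positive real part; at 0 the derivative is
  \<open>deriv g 0 * (s q(0) + 1 - s)\<close>.\<close>

lemma combination_deriv_nz:
  assumes z: "z \<in> \<D>" and s: "0 \<le> s" "s \<le> (1::real)"
  shows "of_real s * deriv f z + of_real (1 - s) * deriv g z \<noteq> 0"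
proof (cases "z = 0")
  case True
  have "of_real s * deriv f z + of_real (1 - s) * deriv g z = deriv g 0 * (of_real s * q 0 + of_real (1 - s))"
    using True by (simp add: f'0 algebra_simps)
  moreover have "s * Re (q 0) + (1 - s) > 0"
  proof (cases "s = 0")
    case False
    then have "s * Re (q 0) > 0" using q[of 0] s by simp
    then show ?thesis using s by linarith
  qed simp
  then have "of_real s * q 0 + of_real (1 - s) \<noteq> (0::complex)" by (auto simp: complex_eq_iff)
  ultimately show ?thesis using g'_nz[of 0] by simp
next
  case False
  show ?thesis
  proof (cases "s = 0")
    case True
    then show ?thesis using g'_nz[OF z] by simp
  next
    case s0: False
    obtain k where k: "Re k > 0" "z * (of_real s * deriv f z + of_real (1 - s) * deriv g z) = g z * k"
      by (rule combination_factor[OF z False, of s "1 - s"]) (use s s0 in auto)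
    then have "k \<noteq> 0" by auto
    then have "z * (of_real s * deriv f z + of_real (1 - s) * deriv g z) \<noteq> 0"
      unfolding k(2) using g_nz[OF z False] by simp
    then show ?thesis by (metis mult_zero_right)
  qed
qed

text \<open>Solving for \<open>t\<close> gives \<open>\<tau> = (C - f) / g\<close> with \<open>z \<tau>' = - (q + t z g' / g)\<close>, which has negative
  real part. With \<open>t = (1 - s) / s\<close> a collision \<open>H s z = H s w\<close> therefore persists inside the same
  disc when \<open>s\<close> decreases, so no collision has a least \<open>s\<close>.\<close>

lemma solution_moves_inwards:
  assumes v: "v \<in> \<D>" and t: "t \<ge> 0" and C: "f v + of_real t * g v = C" and \<eta>: "\<eta> > 0"
  obtains \<epsilon> where "\<epsilon> > 0"
    "\<And>e. 0 < e \<Longrightarrow> e < \<epsilon> \<Longrightarrow> \<exists>v'. cmod v' \<le> cmod v \<and> dist v v' < \<eta> \<and> f v' + of_real (t + e) * g v' = C"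
proof (cases "v = 0")
  case True
  \<comment> \<open>As \<open>g 0 = 0\<close>, the equation at \<open>v = 0\<close> does not involve
    the parameter, and \<open>v' = 0\<close> solves it for every \<open>e\<close>.\<close>
  show ?thesis
    by (rule that[of 1]) (use True C \<eta> g0 in auto)
next
  case False
  define \<tau> where "\<tau> = (\<lambda>u. (C - f u) / g u)"
  have \<tau>h: "\<tau> holomorphic_on \<D> - {0}"
    unfolding \<tau>_def using g_nz
    by (intro holomorphic_intros holomorphic_on_subset[OF f] holomorphic_on_subset[OF g]) auto
  have op: "open (\<D> - {0::complex})" by auto
  have vS: "v \<in> \<D> - {0}" using v False by auto
  have \<tau>v: "\<tau> v = of_real t" using C g_nz[OF v False] by (auto simp: \<tau>_def field_simps)
  obtain k where k: "Re k > 0" "v * (of_real 1 * deriv f v + of_real t * deriv g v) = g v * k"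
    by (rule combination_factor[OF v False, of 1 t]) (use t in auto)
  have "(\<tau> has_field_derivative ((- deriv f v) * g v - (C - f v) * deriv g v) / (g v * g v)) (at v)"
    unfolding \<tau>_def using holomorphic_derivI[OF f _ v] holomorphic_derivI[OF g _ v] g_nz[OF v False]
    by (auto intro!: derivative_eq_intros)
  moreover have "((- deriv f v) * g v - (C - f v) * deriv g v) / (g v * g v) = - k / v"
  proof -
    have "C - f v = of_real t * g v" using C by (simp add: algebra_simps)
    then have "((- deriv f v) * g v - (C - f v) * deriv g v) / (g v * g v) = - (deriv f v + of_real t * deriv g v) / g v"
      using g_nz[OF v False] by (simp add: field_simps)
    also have "\<dots> = - (v * (deriv f v + of_real t * deriv g v)) / (v * g v)"
      using False by (metis mult_divide_mult_cancel_left mult_minus_right)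
    also have "\<dots> = - (g v * k) / (v * g v)" using k(2) by simp
    also have "\<dots> = - k / v" using g_nz[OF v False] by simp
    finally show ?thesis .
  qed
  ultimately have d\<tau>: "deriv \<tau> v = - k / v" by (simp add: DERIV_imp_deriv)
  then have d\<tau>0: "deriv \<tau> v \<noteq> 0" using k False by auto
  obtain r0 where r0: "r0 > 0" "ball v r0 \<subseteq> \<D> - {0}" "inj_on \<tau> (ball v r0)"
    using has_complex_derivative_locally_injective[OF \<tau>h vS op d\<tau>0] by blast
  define r where "r = min r0 \<eta>"
  have "ball v r \<subseteq> ball v r0" by (rule subset_ball) (simp add: r_def)
  then have r: "ball v r \<subseteq> \<D> - {0}" "inj_on \<tau> (ball v r)"
    using r0(2,3) by (blast intro: inj_on_subset)+
  have r_pos: "r > 0" "r \<le> \<eta>" using r0(1) \<eta> by (simp_all add: r_def)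
  have \<tau>hr: "\<tau> holomorphic_on ball v r" using \<tau>h r(1) by (rule holomorphic_on_subset)
  obtain \<psi> where \<psi>h: "\<psi> holomorphic_on \<tau> ` ball v r"
    and \<psi>: "\<And>z. z \<in> ball v r \<Longrightarrow> \<psi> (\<tau> z) = z"
    and \<psi>': "\<And>z. z \<in> ball v r \<Longrightarrow> deriv \<tau> z * deriv \<psi> (\<tau> z) = 1"
    using holomorphic_has_inverse[OF \<tau>hr open_ball r(2)] by metis
  have opi: "open (\<tau> ` ball v r)" by (rule open_mapping_thm3[OF \<tau>hr open_ball r(2)])
  have ti: "of_real t \<in> \<tau> ` ball v r" using \<tau>v r_pos(1) by (metis centre_in_ball imageI)
  then obtain \<delta> where \<delta>: "\<delta> > 0" "ball (of_real t) \<delta> \<subseteq> \<tau> ` ball v r"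
    using opi by (meson open_contains_ball)
  have vr: "v \<in> ball v r" using r_pos by simp
  have "(\<psi> has_field_derivative deriv \<psi> (of_real t)) (at (of_real t))"
    by (rule holomorphic_derivI[OF \<psi>h opi ti])
  moreover have "deriv \<psi> (of_real t) = - v / k"
    using \<psi>'[OF vr] d\<tau> k(1) False unfolding \<tau>v by (auto simp: field_simps eq_neg_iff_add_eq_0)
  moreover define D where "D = - v / k"
  ultimately have "(\<psi> has_field_derivative D) (at (of_real t))" by simp
  from has_vector_derivative_real_field[OF this]
  have d\<psi>: "((\<lambda>x. \<psi> (of_real x)) has_vector_derivative D) (at t)" .
  \<comment> \<open>Squared modulus of the solution \<open>\<psi> x\<close> for the parameter
    \<open>x\<close>. Its derivative at \<open>t\<close> is
    \<open>2 Re (cnj v * D) = - 2 |v|^2 Re (1 / k) < 0\<close>.\<close>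
  define N where "N = (\<lambda>x::real. (Re (\<psi> (of_real x)))\<^sup>2 + (Im (\<psi> (of_real x)))\<^sup>2)"
  have \<psi>t: "\<psi> (of_real t) = v" using \<psi>[OF vr] \<tau>v by simp
  have "(N has_real_derivative 2 * Re v * Re D + 2 * Im v * Im D) (at t)"
    unfolding N_def
    using DERIV_add[OF DERIV_power[OF has_field_derivative_Re[OF d\<psi>], of 2] DERIV_power[OF has_field_derivative_Im[OF d\<psi>], of 2]]
    by (simp add: \<psi>t mult_ac)
  moreover have "2 * Re v * Re D + 2 * Im v * Im D < 0"
  proof -
    have "Re v * Re D + Im v * Im D = Re (cnj v * D)" by simp
    also have "cnj v * D = - (of_real ((cmod v)\<^sup>2) * inverse k)"
      by (simp add: D_def divide_inverse complex_norm_square del: of_real_power)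
    also have "Re \<dots> = - ((cmod v)\<^sup>2 * Re (inverse k))" by (simp only: uminus_complex.sel Re_of_real_mult)
    also have "\<dots> < 0"
    proof -
      have "Re (inverse k) > 0" using k(1) by (simp only: Re_inverse_pos_iff)
      then have "(cmod v)\<^sup>2 * Re (inverse k) > 0" using False by (intro mult_pos_pos) simp_all
      then show ?thesis by linarith
    qed
    finally show ?thesis by simp
  qed
  ultimately obtain d where d: "d > 0" "\<And>h. 0 < h \<Longrightarrow> h < d \<Longrightarrow> N (t + h) < N t"
    using DERIV_neg_dec_right by metis
  show ?thesis
  proof (rule that[of "min d \<delta>"])
    show "min d \<delta> > 0" using d \<delta> by simp
    fix e assume e: "0 < e" "e < min d \<delta>"
    have "of_real (t + e) \<in> ball (complex_of_real t) \<delta>" using e by (simp add: dist_norm)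
    then obtain v' where v': "v' \<in> ball v r" "\<tau> v' = of_real (t + e)" using \<delta>(2) by (metis imageE subsetD)
    have "\<psi> (of_real (t + e)) = v'" using \<psi>[OF v'(1)] v'(2) by simp
    then have "(cmod v')\<^sup>2 < (cmod v)\<^sup>2" using d(2)[of e] e by (simp add: N_def \<psi>t cmod_power2)
    then have "cmod v' \<le> cmod v" by (simp add: power2_less_imp_less less_imp_le)
    moreover have "f v' + of_real (t + e) * g v' = C"
    proof -
      have "v' \<in> \<D> - {0}" using v'(1) r(1) by (rule subsetD[rotated])
      then have "v' \<in> \<D>" "v' \<noteq> 0" by blast+
      then show ?thesis using v'(2) g_nz[of v'] by (simp add: \<tau>_def field_simps)
    qed
    ultimately show "\<exists>v'. cmod v' \<le> cmod v \<and> dist v v' < \<eta> \<and> f v' + of_real (t + e) * g v' = C"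
      using v'(1) r_pos(2) by (intro exI[of _ v']) auto
  qed
qed

definition H :: "real \<Rightarrow> complex \<Rightarrow> complex"
  where "H s z = of_real s * f z + of_real (1 - s) * g z"

text \<open>By joint continuity the derivative stays within \<open>|a| / 2\<close> of its nonzero
  value \<open>a\<close>, so \<open>H s' u - a u\<close> is Lipschitz with constant
  \<open>|a| / 2\<close> and cannot offset \<open>a (x - y)\<close>. Uniformity in \<open>s'\<close>
  prevents colliding pairs from merging in a limit.\<close>

lemma H_locally_uniformly_injective:
  assumes z: "z \<in> \<D>" and s: "0 \<le> s" "s \<le> 1"
  obtains \<delta> where "\<delta> > 0"
    "\<And>s' x y. \<bar>s' - s\<bar> < \<delta> \<Longrightarrow> dist z x < \<delta> \<Longrightarrow> dist z y < \<delta> \<Longrightarrow> x \<noteq> y \<Longrightarrow> H s' x \<noteq> H s' y"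
proof -
  define H' where "H' = (\<lambda>p. of_real (fst p) * deriv f (snd p) + of_real (1 - fst p) * deriv g (snd p))"
  define a where "a = H' (s, z)"
  have a: "a \<noteq> 0" using combination_deriv_nz[OF z s] by (simp add: a_def H'_def)
  have cf: "continuous_on (UNIV \<times> \<D>) (\<lambda>p. deriv h (snd p))" if "h holomorphic_on \<D>" for h and p :: "real \<times> complex"
    by (rule continuous_on_compose2[OF holomorphic_on_imp_continuous_on[OF holomorphic_deriv[OF that open_ball]]])
       (auto intro!: continuous_intros)
  have "continuous_on (UNIV \<times> \<D>) H'"
    unfolding H'_def by (intro continuous_intros cf f g)
  moreover have "open (UNIV \<times> \<D> :: (real \<times> complex) set)" by (intro open_Times) auto
  ultimately have "isCont H' (s, z)" using z by (simp add: continuous_on_eq_continuous_at)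
  then obtain d where d: "d > 0" "\<And>p. dist p (s, z) < d \<Longrightarrow> dist (H' p) a < cmod a / 2"
    using a unfolding continuous_at_eps_delta a_def by (metis half_gt_zero zero_less_norm_iff)
  obtain e where e: "e > 0" "ball z e \<subseteq> \<D>" using z by (meson open_ball open_contains_ball)
  \<comment> \<open>Half of \<open>d\<close> for each coordinate, since the product distance is at
    most the sum of the two.\<close>
  define \<delta> where "\<delta> = min (d / 2) e"
  have \<delta>: "\<delta> > 0" "\<delta> \<le> d / 2" "ball z \<delta> \<subseteq> \<D>" using d e by (auto simp: \<delta>_def)
  show ?thesis
  proof (rule that[OF \<delta>(1)])
    fix s' x y assume s': "\<bar>s' - s\<bar> < \<delta>" and x: "dist z x < \<delta>" and y: "dist z y < \<delta>" and "x \<noteq> y"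
    have bound: "cmod (H' (s', u) - a) \<le> cmod a / 2" if "u \<in> ball z \<delta>" for u
    proof -
      have "dist (s', u) (s, z) = sqrt ((dist s' s)\<^sup>2 + (dist u z)\<^sup>2)" by (rule dist_Pair_Pair)
      also have "\<dots> \<le> dist s' s + dist u z" by (rule sqrt_sum_squares_le_sum) auto
      also have "\<dots> = \<bar>s' - s\<bar> + dist u z" by (simp add: dist_real_def)
      also have "\<dots> < d" using s' that \<delta>(2) by (simp add: dist_commute)
      finally show ?thesis using d(2) by (simp add: dist_norm less_imp_le)
    qed
    define h where "h = (\<lambda>u. H s' u - a * u)"
    have "cmod (h x - h y) \<le> cmod a / 2 * cmod (x - y)"
    proof (rule field_differentiable_bound[of "ball z \<delta>"])
      fix u assume u: "u \<in> ball z \<delta>"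
      then have "u \<in> \<D>" using \<delta>(3) by blast
      then have "(h has_field_derivative (H' (s', u) - a)) (at u)"
        unfolding h_def H_def H'_def
        using holomorphic_derivI[OF f open_ball] holomorphic_derivI[OF g open_ball]
        by (auto intro!: derivative_eq_intros)
      then show "(h has_field_derivative (H' (s', u) - a)) (at u within ball z \<delta>)"
        by (rule has_field_derivative_at_within)
      show "cmod (H' (s', u) - a) \<le> cmod a / 2" by (rule bound[OF u])
    qed (use x y in auto)
    show "H s' x \<noteq> H s' y"
    proof
      assume "H s' x = H s' y"
      then have "h x - h y = - (a * (x - y))" by (simp add: h_def algebra_simps)
      then have "cmod (h x - h y) = cmod a * cmod (x - y)" by (simp add: norm_mult)
      then show False using \<open>cmod (h x - h y) \<le> _\<close> a \<open>x \<noteq> y\<close> by simp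
    qed
  qed
qed

text \<open>The collisions form a compact set, so one of them has the least parameter
  \<open>s\<close>. Injectivity of \<open>g\<close> excludes \<open>s = 0\<close>, and moving both
  points inwards excludes \<open>s > 0\<close>.\<close>

lemma inj_f: "inj_on f \<D>"
proof (rule inj_onI, rule ccontr)
  fix x y assume x: "x \<in> \<D>" and y: "y \<in> \<D>" and fxy: "f x = f y" and xy: "x \<noteq> y"
  \<comment> \<open>Solutions never move outwards, so all collisions can be sought in this closed
    disc, which makes compactness available.\<close>
  define \<rho> where "\<rho> = max (cmod x) (cmod y)"
  have \<rho>: "\<rho> < 1" using x y by (simp add: \<rho>_def)
  then have sub: "cball 0 \<rho> \<subseteq> \<D>" by auto
  define K where "K = {0..1::real} \<times> cball (0::complex) \<rho> \<times> cball (0::complex) \<rho>"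
  have K: "compact K" unfolding K_def by (intro compact_Times) auto
  define P where "P = {p \<in> K. fst (snd p) \<noteq> snd (snd p) \<and> H (fst p) (fst (snd p)) = H (fst p) (snd (snd p))}"
  have cont: "continuous_on K (\<lambda>p. H (fst p) (fst (snd p)) - H (fst p) (snd (snd p)))"
  proof -
    have *: "continuous_on K (\<lambda>p. h (fst (snd p)))" "continuous_on K (\<lambda>p. h (snd (snd p)))"
      if "h holomorphic_on \<D>" for h
      by (rule continuous_on_compose2[OF holomorphic_on_imp_continuous_on[OF that]],
          use sub in \<open>auto intro!: continuous_intros simp: K_def\<close>)+
    show ?thesis unfolding H_def by (intro continuous_intros * f g)
  qed
  have "closed P"
    unfolding closed_sequential_limits
  proof (intro allI impI, elim conjE)
    fix X p assume X: "\<forall>n. X n \<in> P" and lim: "X \<longlonglongrightarrow> p"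
    have pK: "p \<in> K"
      using compact_imp_closed[OF K] X lim unfolding closed_sequential_limits P_def by blast
    obtain s z w where p: "p = (s, z, w)" by (metis prod.exhaust)
    have lims: "(\<lambda>n. fst (X n)) \<longlonglongrightarrow> s" "(\<lambda>n. fst (snd (X n))) \<longlonglongrightarrow> z" "(\<lambda>n. snd (snd (X n))) \<longlonglongrightarrow> w"
      using tendsto_fst[OF lim] tendsto_fst[OF tendsto_snd[OF lim]] tendsto_snd[OF tendsto_snd[OF lim]] p by auto
    have "(\<lambda>n. H (fst (X n)) (fst (snd (X n))) - H (fst (X n)) (snd (snd (X n)))) \<longlonglongrightarrow>
        H (fst p) (fst (snd p)) - H (fst p) (snd (snd p))"
      using continuous_on_tendsto_compose[OF cont lim pK] X by (auto simp: P_def)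
    moreover have "(\<lambda>n. H (fst (X n)) (fst (snd (X n))) - H (fst (X n)) (snd (snd (X n)))) = (\<lambda>n. 0)"
      using X by (auto simp: P_def)
    ultimately have Heq: "H s z = H s w" using LIMSEQ_unique[OF tendsto_const] p by fastforce
    have "z \<noteq> w"
    proof
      assume zw: "z = w"
      have "z \<in> \<D>" "0 \<le> s" "s \<le> 1" using pK p sub by (auto simp: K_def)
      from H_locally_uniformly_injective[OF this] obtain \<delta> where \<delta>: "\<delta> > 0"
        "\<And>s' x y. \<bar>s' - s\<bar> < \<delta> \<Longrightarrow> dist z x < \<delta> \<Longrightarrow> dist z y < \<delta> \<Longrightarrow> x \<noteq> y \<Longrightarrow> H s' x \<noteq> H s' y" by blast
      have "eventually (\<lambda>n. dist (fst (X n)) s < \<delta> \<and> dist (fst (snd (X n))) z < \<delta> \<and> dist (snd (snd (X n))) w < \<delta>) sequentially"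
        using lims \<delta>(1) by (intro eventually_conj tendstoD)
      then obtain n where n: "dist (fst (X n)) s < \<delta>" "dist (fst (snd (X n))) z < \<delta>" "dist (snd (snd (X n))) w < \<delta>"
        by (auto simp: eventually_sequentially)
      have "H (fst (X n)) (fst (snd (X n))) \<noteq> H (fst (X n)) (snd (snd (X n)))"
        by (rule \<delta>(2)) (use n X zw in \<open>auto simp: dist_commute dist_real_def P_def\<close>)
      then show False using X by (auto simp: P_def)
    qed
    then show "p \<in> P" using Heq pK p by (simp add: P_def)
  qed
  then have "compact (K \<inter> P)" using K by (rule compact_Int_closed[rotated])
  moreover have "K \<inter> P = P" by (auto simp: P_def)
  ultimately have Pc: "compact P" by simp
  have "(1, x, y) \<in> P" using xy fxy by (auto simp: P_def K_def H_def \<rho>_def)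
  then obtain p where p: "p \<in> P" and pmin: "\<And>p'. p' \<in> P \<Longrightarrow> fst p \<le> fst p'"
    using continuous_attains_inf[OF Pc _ continuous_on_fst[OF continuous_on_id]] by blast
  obtain s z w where pe: "p = (s, z, w)" by (metis prod.exhaust)
  have s: "0 \<le> s" "s \<le> 1" and z: "cmod z \<le> \<rho>" and w: "cmod w \<le> \<rho>" and zw: "z \<noteq> w" and Hzw: "H s z = H s w"
    using p pe by (auto simp: P_def K_def)
  have zD: "z \<in> \<D>" and wD: "w \<in> \<D>" using z w \<rho> by auto
  have "s \<noteq> 0"
  proof
    assume "s = 0"
    then show False using Hzw inj_onD[OF g_inj _ zD wD] zw by (simp add: H_def)
  qed
  then have s0: "s > 0" using s by simp
  define t where "t = (1 - s) / s"
  have t: "t \<ge> 0" using s s0 by (simp add: t_def)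
  have Hs: "H (1 / (1 + t')) v = (f v + of_real t' * g v) / of_real (1 + t')" if "t' \<ge> 0" for t' v
  proof -
    have "1 - 1 / (1 + t') = t' / (1 + t')" using that by (simp add: field_simps)
    then show ?thesis by (simp add: H_def add_divide_distrib)
  qed
  have st: "s = 1 / (1 + t)" using s0 by (simp add: t_def field_simps)
  define C where "C = f z + of_real t * g z"
  have "of_real (1 + t) \<noteq> (0::complex)" using t by (simp only: of_real_eq_0_iff)
  then have Cw: "f w + of_real t * g w = C"
    using Hzw Hs[OF t] st by (simp add: C_def del: of_real_add)
  \<comment> \<open>Moving each point by less than half of their distance keeps the two new points
    distinct.\<close>
  have \<eta>: "dist z w / 2 > 0" using zw by simp
  obtain e1 where e1: "e1 > 0"
    "\<And>e. 0 < e \<Longrightarrow> e < e1 \<Longrightarrow> \<exists>v'. cmod v' \<le> cmod z \<and> dist z v' < dist z w / 2 \<and> f v' + of_real (t + e) * g v' = C"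
    using solution_moves_inwards[OF zD t C_def[symmetric] \<eta>] by blast
  obtain e2 where e2: "e2 > 0"
    "\<And>e. 0 < e \<Longrightarrow> e < e2 \<Longrightarrow> \<exists>v'. cmod v' \<le> cmod w \<and> dist w v' < dist z w / 2 \<and> f v' + of_real (t + e) * g v' = C"
    using solution_moves_inwards[OF wD t Cw \<eta>] by blast
  define e where "e = min e1 e2 / 2"
  have e: "0 < e" "e < e1" "e < e2" using e1(1) e2(1) by (auto simp: e_def)
  obtain z' where z': "cmod z' \<le> cmod z" "dist z z' < dist z w / 2" "f z' + of_real (t + e) * g z' = C"
    using e1(2)[OF e(1,2)] by blast
  obtain w' where w': "cmod w' \<le> cmod w" "dist w w' < dist z w / 2" "f w' + of_real (t + e) * g w' = C"
    using e2(2)[OF e(1,3)] by blast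
  have "z' \<noteq> w'" using z'(2) w'(2) dist_triangle[of z w z'] by (auto simp: dist_commute)
  define s' where "s' = 1 / (1 + (t + e))"
  have s': "0 \<le> s'" "s' < s" using t e(1) by (auto simp: s'_def st field_simps)
  have "H s' z' = H s' w'" using Hs[of "t + e"] t e(1) z'(3) w'(3) by (simp add: s'_def)
  then have "(s', z', w') \<in> P"
    using \<open>z' \<noteq> w'\<close> s' s z'(1) w'(1) z w by (auto simp: P_def K_def)
  then show False using pmin[of "(s', z', w')"] pe s'(2) by simp
qed

end

subsection \<open>Bounds for the class\<close>

lemma taylor_coeff_deriv_eq_mult:
  assumes f: "f holomorphic_on \<D>" and g: "g holomorphic_on \<D>" and q: "q holomorphic_on \<D>"
    and eq: "\<And>z. z \<in> \<D> \<Longrightarrow> z * deriv f z = q z * g z"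
  shows "of_nat n * taylor_coeff f n = (\<Sum>i\<le>n. taylor_coeff q i * taylor_coeff g (n - i))"
proof -
  let ?F = "fps_expansion f 0" and ?G = "fps_expansion g 0" and ?Q = "fps_expansion q 0"
  have "(\<lambda>z. z * deriv f z) has_fps_expansion fps_X * fps_deriv ?F"
    by (intro fps_expansion_intros has_fps_expansion_disc f)
  moreover have "(\<lambda>z. q z * g z) has_fps_expansion ?Q * ?G"
    by (intro fps_expansion_intros has_fps_expansion_disc g q)
  moreover have "(\<lambda>z. z * deriv f z) has_fps_expansion ?Q * ?G \<longleftrightarrow> (\<lambda>z. q z * g z) has_fps_expansion ?Q * ?G"
    using eventually_nhds_in_open[of "\<D>" 0]
    by (intro has_fps_expansion_cong) (auto simp: eq elim!: eventually_mono)
  ultimately have eqF: "fps_X * fps_deriv ?F = ?Q * ?G"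
    using fps_expansion_unique_complex by blast
  have "of_nat n * taylor_coeff f n = fps_nth (fps_X * fps_deriv ?F) n"
    by (cases n) simp_all
  then show ?thesis unfolding eqF by (simp add: fps_mult_nth atLeast0AtMost)
qed

text \<open>Clearing the denominator includes \<open>z = 0\<close>, and comparing first coefficients
  gives \<open>q 0 * deriv g 0 = 1\<close>. This normalization makes the unknown moduli cancel in
  the later bounds.\<close>

lemma C1_witness:
  assumes "f \<in> \<C>\<^sub>1"
  obtains g q where "convex_function g" "g 0 = 0" "q holomorphic_on \<D>"
    "\<And>z. z \<in> \<D> \<Longrightarrow> Re (q z) > 0" "\<And>z. z \<in> \<D> \<Longrightarrow> z * deriv f z = q z * g z"
    "q 0 * deriv g 0 = 1"
proof -
  have f: "f holomorphic_on \<D>" "deriv f 0 = 1" using assms by (auto simp: class_C1_def)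
  obtain g q where g: "convex_function g" "g 0 = 0" and q: "q holomorphic_on \<D>"
    "\<And>z. z \<in> \<D> \<Longrightarrow> Re (q z) > 0" "\<And>z. z \<in> \<D> - {0} \<Longrightarrow> q z = z * deriv f z / g z"
    using assms unfolding class_C1_def by blast
  have gh: "g holomorphic_on \<D>" and ginj: "inj_on g \<D>" using g by (auto simp: convex_function_def)
  have eq: "z * deriv f z = q z * g z" if z: "z \<in> \<D>" for z
  proof (cases "z = 0")
    case False
    then have "g z \<noteq> 0" using inj_onD[OF ginj, of z 0] z g(2) by auto
    then show ?thesis using q(3)[of z] z False by simp
  qed (use g in simp)
  have "q 0 * deriv g 0 = 1"
    using taylor_coeff_deriv_eq_mult[OF f(1) gh q(1) eq, of 1] f(2) g(2) by (simp add: fps_expansion_def)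
  then show ?thesis using that g q eq by blast
qed

lemma C1_inj:
  assumes "f \<in> \<C>\<^sub>1"
  shows "inj_on f \<D>"
proof -
  have f: "f holomorphic_on \<D>" "deriv f 0 = 1" using assms by (auto simp: class_C1_def)
  obtain g q where w: "convex_function g" "g 0 = 0" "q holomorphic_on \<D>"
    "\<And>z. z \<in> \<D> \<Longrightarrow> Re (q z) > 0" "\<And>z. z \<in> \<D> \<Longrightarrow> z * deriv f z = q z * g z"
    "q 0 * deriv g 0 = 1" using C1_witness[OF assms] by blast
  interpret close_to_starlike f g q
    using f w starlike_of_convex[OF w(1,2)] by unfold_locales (auto simp: convex_function_def)
  show ?thesis by (rule inj_f)
qed

text \<open>The lower bounds for \<open>q\<close> and for \<open>g\<close> multiply,
  \<open>|q 0| |deriv g 0| = 1\<close> drops out, and a factor \<open>|z|\<close> is divided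
  off.\<close>

lemma C1_deriv_lower_bound:
  assumes "f \<in> \<C>\<^sub>1" and z: "z \<in> \<D>"
  shows "(1 - cmod z) / (1 + cmod z)\<^sup>2 \<le> cmod (deriv f z)"
proof (cases "z = 0")
  case True
  then show ?thesis using assms by (simp add: class_C1_def)
next
  case False
  obtain g q where g: "convex_function g" "g 0 = 0" and q: "q holomorphic_on \<D>"
    "\<And>z. z \<in> \<D> \<Longrightarrow> Re (q z) > 0" and eq: "\<And>z. z \<in> \<D> \<Longrightarrow> z * deriv f z = q z * g z"
    and "q 0 * deriv g 0 = 1" using C1_witness[OF assms(1)] by blast
  then have 1: "cmod (q 0) * cmod (deriv g 0) = 1" by (metis norm_mult norm_one)
  define r where "r = cmod z"
  have r: "0 < r" "r < 1" using False z by (auto simp: r_def)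
  have "r * ((1 - r) / (1 + r)\<^sup>2) = (cmod (q 0) * cmod (deriv g 0)) * r * (1 - r) / (1 + r)\<^sup>2"
    unfolding 1 by simp
  also have "\<dots> = (cmod (q 0) * (1 - r) / (1 + r)) * (cmod (deriv g 0) * r / (1 + r))"
    by (simp add: power2_eq_square)
  also have "\<dots> \<le> cmod (q z) * cmod (g z)"
    unfolding r_def using r z
    by (intro mult_mono halfplane_lower_bound q convex_function_lower_growth g) auto
  also have "\<dots> = r * cmod (deriv f z)" unfolding r_def norm_mult[symmetric] eq[OF z] ..
  finally have "(1 - r) / (1 + r)\<^sup>2 \<le> cmod (deriv f z)" using r by (metis mult_le_cancel_left_pos)
  then show ?thesis by (simp add: r_def)
qed

text \<open>Coefficients of the extremal function. Index 0 is treated apart because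
  \<open>1 / 0 = 0\<close> would give 2 there.\<close>

definition growth_coeff :: "nat \<Rightarrow> real"
  where "growth_coeff n = (if n = 0 then 0 else 2 - 1 / real n)"

lemma growth_coeff_nonneg: "growth_coeff n \<ge> 0"
proof (cases "n = 0")
  case False
  then have "1 / real n \<le> 1" by simp
  then show ?thesis by (simp add: growth_coeff_def)
qed (simp add: growth_coeff_def)

text \<open>In the Cauchy product for \<open>n a_n\<close> the term \<open>i = 0\<close> is at most
  1, the term \<open>i = n\<close> vanishes because \<open>g 0 = 0\<close>, and the
  \<open>n - 1\<close> others are at most 2; the total is \<open>2 n - 1\<close>.\<close>

lemma C1_coeff_bound:
  assumes "f \<in> \<C>\<^sub>1"
  shows "cmod (taylor_coeff f n) \<le> growth_coeff n"
proof (cases "n = 0")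
  case True
  then show ?thesis using assms by (simp add: growth_coeff_def class_C1_def fps_expansion_def)
next
  case False
  have f: "f holomorphic_on \<D>" using assms by (auto simp: class_C1_def)
  obtain g q where g: "convex_function g" "g 0 = 0" and q: "q holomorphic_on \<D>"
    "\<And>z. z \<in> \<D> \<Longrightarrow> Re (q z) > 0" and eq: "\<And>z. z \<in> \<D> \<Longrightarrow> z * deriv f z = q z * g z"
    and "q 0 * deriv g 0 = 1" using C1_witness[OF assms] by blast
  then have 1: "cmod (q 0) * cmod (deriv g 0) = 1" by (metis norm_mult norm_one)
  have gh: "g holomorphic_on \<D>" using g by (simp add: convex_function_def)
  have b: "cmod (taylor_coeff g k) \<le> cmod (deriv g 0)" for k
    using subordinate_convex_coeff[OF g(1) gh order_refl refl, of k] g(2)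
    by (cases "k = 0") (auto simp: fps_expansion_def)
  have q0: "taylor_coeff q 0 = q 0" by (simp add: fps_expansion_def)
  have qb: "cmod (taylor_coeff q k) \<le> 2 * cmod (q 0)" if "k > 0" for k
    using halfplane_coeff[OF q that] complex_Re_le_cmod[of "q 0"] by simp
  have "real n * cmod (taylor_coeff f n) = cmod (\<Sum>i\<le>n. taylor_coeff q i * taylor_coeff g (n - i))"
    using arg_cong[OF taylor_coeff_deriv_eq_mult[OF f gh q(1) eq, of n], of cmod] by (simp add: norm_mult)
  also have "\<dots> \<le> (\<Sum>i\<le>n. cmod (taylor_coeff q i * taylor_coeff g (n - i)))" by (rule norm_sum)
  also have "\<dots> \<le> (\<Sum>i\<le>n. if i = 0 then 1 else if i = n then 0 else 2)"
  proof (rule sum_mono)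
    fix i assume "i \<in> {..n}"
    consider "i = 0" | "i = n" "i > 0" | "0 < i" "i < n" using \<open>i \<in> {..n}\<close> by force
    then show "cmod (taylor_coeff q i * taylor_coeff g (n - i)) \<le> (if i = 0 then 1 else if i = n then 0 else 2)"
    proof cases
      case 1
      have "cmod (taylor_coeff q 0 * taylor_coeff g n) \<le> cmod (q 0) * cmod (deriv g 0)"
        unfolding q0 norm_mult by (intro mult_left_mono b) simp
      then show ?thesis using 1 \<open>cmod (q 0) * _ = 1\<close> by simp
    next
      case 2
      then show ?thesis using g(2) by (simp add: fps_expansion_def)
    next
      case 3
      have "cmod (taylor_coeff q i * taylor_coeff g (n - i)) \<le> 2 * cmod (q 0) * cmod (deriv g 0)"
        unfolding norm_mult by (intro mult_mono qb b) (use 3 in auto)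
      then show ?thesis using 3 1 by (simp add: mult.assoc)
    qed
  qed
  also have "(\<Sum>i\<le>n. if i = 0 then 1 else if i = n then 0 else 2) = 2 * real n - 1"
  proof -
    obtain k where k: "n = Suc k" using False by (cases n) auto
    have "(\<Sum>i\<le>n. if i = 0 then 1 else if i = n then 0 else 2) = 1 + (\<Sum>i\<le>k. if i = k then 0 else 2 :: real)"
      unfolding k sum.atMost_Suc_shift by simp
    also have "(\<Sum>i\<le>k. if i = k then 0 else 2 :: real) = (\<Sum>i<k. 2)"
      unfolding lessThan_Suc_atMost[symmetric] sum.lessThan_Suc by (simp cong: sum.cong_simp)
    finally show ?thesis by (simp add: k)
  qed
  finally show ?thesis using False by (simp add: growth_coeff_def field_simps)
qed

text \<open>The function \<open>m\<close> is the antiderivative of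
  \<open>(1 - s) / (1 + s)^2\<close> vanishing at 0, and it tends to \<open>1 - ln 2\<close> as
  \<open>s\<close> tends to 1.\<close>

lemma C1_covering:
  assumes "f \<in> \<C>\<^sub>1" and w: "cmod w < 1 - ln 2"
  shows "w \<in> f ` \<D>"
proof -
  define m where "m = (\<lambda>s::real. 2 * s / (1 + s) - ln (1 + s))"
  have "(m \<longlongrightarrow> 2 * 1 / (1 + 1) - ln (1 + 1)) (at_left 1)"
    unfolding m_def by (intro tendsto_intros) auto
  then have "eventually (\<lambda>s. cmod w < m s) (at_left 1)"
    using w by (intro order_tendstoD) simp_all
  then obtain b where "b < 1" "\<And>s. b < s \<Longrightarrow> s < 1 \<Longrightarrow> cmod w < m s"
    by (auto simp: eventually_at_left_field)
  then obtain r where r: "0 < r" "r < 1" "cmod w < m r"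
    using dense[of "max b 0" 1] by auto
  show ?thesis
  proof (rule covering_of_deriv_lower_bound[where m = m and m' = "\<lambda>s. (1 - s) / (1 + s)\<^sup>2"])
    fix s :: real assume s: "0 \<le> s" "s < 1"
    have "(m has_real_derivative (2 * (1 + s) - 2 * s) / ((1 + s) * (1 + s)) - 1 / (1 + s)) (at s)"
      unfolding m_def using s by (auto intro!: derivative_eq_intros)
    moreover have "(2 * (1 + s) - 2 * s) / ((1 + s) * (1 + s)) - 1 / (1 + s) = (1 - s) / (1 + s)\<^sup>2"
      using s by (simp add: divide_simps power2_eq_square) (simp add: algebra_simps)?
    ultimately show "(m has_real_derivative (1 - s) / (1 + s)\<^sup>2) (at s)" by simp
  qed (use assms C1_deriv_lower_bound r in \<open>auto simp: m_def class_C1_def\<close>)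
qed

text \<open>An open image is disjoint from its frontier, so the covered disc contains no frontier
  point. As \<open>infdist\<close> to the empty set is 0, the frontier must be nonempty: otherwise
  the inverse of \<open>f\<close> would be bounded and entire, against Liouville.\<close>

lemma C1_infdist_frontier:
  assumes "f \<in> \<C>\<^sub>1"
  shows "1 - ln 2 \<le> infdist (f 0) (frontier (f ` \<D>))"
proof -
  have f: "f holomorphic_on \<D>" and f0: "f 0 = 0" using assms by (auto simp: class_C1_def)
  note inj = C1_inj[OF assms]
  have op: "open (f ` \<D>)" by (rule open_mapping_thm3[OF f _ inj]) auto
  have "f ` \<D> \<noteq> UNIV"
  proof
    assume U: "f ` \<D> = UNIV"
    obtain fi where fi: "fi holomorphic_on f ` \<D>" "\<And>z. z \<in> \<D> \<Longrightarrow> fi (f z) = z"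
      using disc_inverse[OF f inj] by blast
    have "fi w \<in> \<D>" for w
    proof -
      obtain z where "z \<in> \<D>" "w = f z" using U by blast
      then show ?thesis using fi(2) by simp
    qed
    then have "bounded (range fi)" using bounded_ball bounded_subset by (metis image_subsetI)
    then obtain c where "\<And>w. fi w = c"
      using Liouville_theorem[of fi] fi(1) U by (auto simp: constant_on_def)
    then have "z = c" if "z \<in> \<D>" for z using fi(2)[OF that] by simp
    from this[of 0] this[of "1/2"] show False by simp
  qed
  then have ne: "frontier (f ` \<D>) \<noteq> {}" by (simp add: frontier_eq_empty)
  have "1 - ln 2 \<le> dist (f 0) w" if "w \<in> frontier (f ` \<D>)" for w
  proof (rule ccontr)
    assume "\<not> ?thesis"
    then have "w \<in> f ` \<D>" using C1_covering[OF assms] f0 by simp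
    then show False using that op frontier_disjoint_eq by blast
  qed
  then show ?thesis unfolding infdist_notempty[OF ne] using ne by (intro cINF_greatest) auto
qed

subsection \<open>The majorant and the extremal function\<close>

definition growth_majorant :: "real \<Rightarrow> real"
  where "growth_majorant r = 2 * r / (1 - r) + ln (1 - r)"

definition extremal :: "complex \<Rightarrow> complex"
  where "extremal z = 2 * z / (1 - z) + Ln (1 - z)"

lemma extremal_sums:
  assumes z: "z \<in> \<D>"
  shows "(\<lambda>n. of_real (growth_coeff n) * z ^ n) sums extremal z"
proof -
  have z1: "cmod z < 1" and "z \<noteq> 1" using z by auto
  \<comment> \<open>Twice the geometric series without its constant term, plus the logarithmic
    series, whose term at index 0 is a division by 0 and hence 0.\<close>
  have "(\<lambda>n. 2 * z ^ n - (if n = 0 then 2 else 0) + - ((- (- z)) ^ n) / of_nat n) sums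
      (2 * (1 / (1 - z)) - 2 + ln (1 + - z))"
    using z1 sums_single[of 0 "\<lambda>_. 2 :: complex"]
    by (intro sums_add sums_diff sums_mult geometric_sums Ln_series') auto
  also have "(\<lambda>n. 2 * z ^ n - (if n = 0 then 2 else 0) + - ((- (- z)) ^ n) / of_nat n) =
      (\<lambda>n. of_real (growth_coeff n) * z ^ n)"
    by (auto simp: fun_eq_iff growth_coeff_def algebra_simps)
  also have "2 * (1 / (1 - z)) - 2 + ln (1 + - z) = extremal z"
    using \<open>z \<noteq> 1\<close> by (simp add: extremal_def field_simps)
  finally show ?thesis .
qed

lemma extremal_of_real: "r < 1 \<Longrightarrow> extremal (of_real r) = of_real (growth_majorant r)"
  using Ln_of_real[of "1 - r"] by (simp add: extremal_def growth_majorant_def)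

lemma growth_majorant_sums:
  assumes "0 \<le> r" "r < 1"
  shows "(\<lambda>n. growth_coeff n * r ^ n) sums growth_majorant r"
proof -
  have "(\<lambda>n. complex_of_real (growth_coeff n * r ^ n)) sums of_real (growth_majorant r)"
    using extremal_sums[of "of_real r"] assms by (simp add: extremal_of_real)
  then show ?thesis by (simp only: sums_of_real_iff)
qed

text \<open>The derivative is \<open>(1 + x) / (1 - x)^2\<close>. The endpoint -1, where it
  vanishes, is included because the omitted value of the extremal function is
  \<open>growth_majorant (-1)\<close>.\<close>

lemma growth_majorant_less:
  assumes "-1 \<le> r" "r < s" "s < 1"
  shows "growth_majorant r < growth_majorant s"
proof (rule DERIV_pos_imp_increasing_open[OF \<open>r < s\<close>])
  fix x assume x: "r < x" "x < s"
  have "(growth_majorant has_real_derivative (2 * (1 - x) + 2 * x) / ((1 - x) * (1 - x)) - 1 / (1 - x)) (at x)"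
    unfolding growth_majorant_def using x assms by (auto intro!: derivative_eq_intros)
  moreover have "(2 * (1 - x) + 2 * x) / ((1 - x) * (1 - x)) - 1 / (1 - x) = (1 + x) / (1 - x)\<^sup>2"
    using x assms by (simp add: divide_simps power2_eq_square) (simp add: algebra_simps)?
  moreover have "(1 + x) / (1 - x)\<^sup>2 > 0" using x assms by simp
  ultimately show "\<exists>y. (growth_majorant has_real_derivative y) (at x) \<and> 0 < y" by metis
next
  show "continuous_on {r..s} growth_majorant"
    unfolding growth_majorant_def using assms by (intro continuous_intros) auto
qed

definition growth_tail :: "nat \<Rightarrow> real \<Rightarrow> real"
  where "growth_tail N r = (\<Sum>n. growth_coeff (n + N) * r ^ (n + N))"

lemma growth_tail_summable:
  assumes "0 \<le> r" "r < 1"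
  shows "summable (\<lambda>n. growth_coeff (n + N) * r ^ (n + N))"
  using growth_majorant_sums[OF assms] by (intro summable_ignore_initial_segment) (simp add: sums_iff)

text \<open>Majorant minus a polynomial: in this form the continuity of \<open>bohr_majorant\<close>
  is immediate.\<close>

lemma growth_tail_eq:
  assumes "0 \<le> r" "r < 1"
  shows "growth_tail N r = growth_majorant r - (\<Sum>n<N. growth_coeff n * r ^ n)"
  unfolding growth_tail_def
  using suminf_minus_initial_segment[of "\<lambda>n. growth_coeff n * r ^ n" N] growth_majorant_sums[OF assms]
  by (simp add: sums_iff)

lemma growth_tail_mono:
  assumes "0 \<le> r" "r \<le> s" "s < 1"
  shows "growth_tail N r \<le> growth_tail N s"
  unfolding growth_tail_def using assms
  by (intro suminf_le growth_tail_summable mult_left_mono power_mono growth_coeff_nonneg) auto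

lemma growth_tail_nonneg:
  assumes "0 \<le> r" "r < 1"
  shows "growth_tail N r \<ge> 0"
  unfolding growth_tail_def using assms
  by (intro suminf_nonneg growth_tail_summable mult_nonneg_nonneg growth_coeff_nonneg) auto

definition bohr_majorant :: "nat \<Rightarrow> real \<Rightarrow> real"
  where "bohr_majorant N r = (growth_majorant r)\<^sup>2 + growth_tail N r"

text \<open>For \<open>N > 0\<close> no index \<open>n + N\<close> is 0, the only one at which
  \<open>growth_coeff\<close> departs from \<open>2 - 1 / n\<close>.\<close>

lemma radius_equation_iff:
  assumes "N > 0"
  shows "radius_equation N r \<longleftrightarrow> bohr_majorant N r = 1 - ln 2"
  using assms
  by (simp add: radius_equation_def bohr_majorant_def growth_majorant_def growth_tail_def growth_coeff_def)

lemma growth_majorant_nonneg: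
  assumes "0 \<le> r" "r < 1"
  shows "0 \<le> growth_majorant r"
  using growth_majorant_less[of 0 r] assms by (cases "r = 0") (auto simp: growth_majorant_def)

lemma bohr_majorant_less:
  assumes "0 \<le> r" "r < s" "s < 1"
  shows "bohr_majorant N r < bohr_majorant N s"
proof -
  have "(growth_majorant r)\<^sup>2 < (growth_majorant s)\<^sup>2"
    using assms by (intro power_strict_mono growth_majorant_less growth_majorant_nonneg) auto
  then show ?thesis using growth_tail_mono[of r s N] assms by (simp add: bohr_majorant_def)
qed

text \<open>Intermediate values on \<open>[0, 1/2]\<close>: \<open>bohr_majorant\<close> is 0 at 0,
  while at \<open>1/2\<close> it is at least \<open>(2 - ln 2)^2 > 1\<close>.\<close>

lemma radius_exists:
  assumes "N > 0"
  obtains r where "0 < r" "r < 1" "bohr_majorant N r = 1 - ln 2"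
proof -
  have l2: "ln 2 < (1::real)" "0 < ln (2::real)" by (rule ln_2_less_1) simp
  have g0: "growth_majorant 0 = 0" by (simp add: growth_majorant_def)
  have B0: "bohr_majorant N 0 = 0"
  proof -
    have *: "growth_coeff (n + N) * 0 ^ (n + N) = 0" for n using assms by simp
    show ?thesis unfolding bohr_majorant_def g0 growth_tail_def * by simp
  qed
  have "growth_majorant (1/2) = 2 - ln 2"
    by (simp add: growth_majorant_def ln_div)
  then have "growth_majorant (1/2) > 1" using l2 by simp
  then have "(growth_majorant (1/2))\<^sup>2 > 1" by (simp add: one_less_power)
  then have B1: "bohr_majorant N (1/2) > 1"
    using growth_tail_nonneg[of "1/2" N] by (simp add: bohr_majorant_def)
  have "continuous_on {0..1/2} (\<lambda>r. (growth_majorant r)\<^sup>2 + (growth_majorant r - (\<Sum>n<N. growth_coeff n * r ^ n)))"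
    unfolding growth_majorant_def by (intro continuous_intros) auto
  then have "continuous_on {0..1/2} (bohr_majorant N)"
    by (rule continuous_on_eq) (auto simp: bohr_majorant_def growth_tail_eq)
  then obtain r where r: "0 \<le> r" "r \<le> 1/2" "bohr_majorant N r = 1 - ln 2"
    using IVT'[of "bohr_majorant N" 0 "1 - ln 2" "1/2"] B0 B1 l2 by auto
  then have "r \<noteq> 0" using B0 l2 by auto
  then have "0 < r" "r < 1" using r(1,2) by linarith+
  then show ?thesis using that r(3) by blast
qed

text \<open>Termwise domination by \<open>growth_coeff n * r ^ n\<close> bounds \<open>|f z|\<close>
  and the tail at once.\<close>

lemma C1_bohr_lhs:
  assumes "f \<in> \<C>\<^sub>1" and z: "cmod z \<le> r" "r < 1"
  shows "(cmod (f z))\<^sup>2 + (\<Sum>n. cmod (taylor_coeff f (n + N) * z ^ (n + N))) \<le> bohr_majorant N r"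
proof -
  have r0: "0 \<le> r" using z norm_ge_zero[of z] by linarith
  have f: "f holomorphic_on \<D>" using assms by (auto simp: class_C1_def)
  have le: "cmod (taylor_coeff f n * z ^ n) \<le> growth_coeff n * r ^ n" for n
    unfolding norm_mult norm_power
    by (intro mult_mono C1_coeff_bound assms power_mono growth_coeff_nonneg) auto
  have sums: "(\<lambda>n. taylor_coeff f n * z ^ n) sums f z"
    by (rule has_fps_expansion_imp_sums_complex[OF has_fps_expansion_disc[OF f], where r = 1])
       (use f z in \<open>auto simp: one_ereal_def\<close>)
  have "cmod (f z) \<le> (\<Sum>n. growth_coeff n * r ^ n)"
    using norm_suminf_le[of "\<lambda>n. taylor_coeff f n * z ^ n", OF le] growth_majorant_sums[OF r0 z(2)] sums by (simp add: sums_iff)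
  then have "cmod (f z) \<le> growth_majorant r" using growth_majorant_sums[OF r0 z(2)] by (simp add: sums_iff)
  then have "(cmod (f z))\<^sup>2 \<le> (growth_majorant r)\<^sup>2" by (intro power_mono) auto
  moreover have "(\<Sum>n. cmod (taylor_coeff f (n + N) * z ^ (n + N))) \<le> growth_tail N r"
    unfolding growth_tail_def
    by (intro suminf_le le growth_tail_summable[OF r0 z(2)]
          summable_comparison_test'[OF growth_tail_summable[OF r0 z(2)], of 0]) (use le in auto)
  ultimately show ?thesis by (simp add: bohr_majorant_def)
qed

section \<open>The extremal function and its omitted value\<close>

lemma deriv_extremal:
  assumes "z \<in> \<D>"
  shows "(extremal has_field_derivative (1 + z) / (1 - z)\<^sup>2) (at z)"
proof -
  have "z \<noteq> 1" using assms by auto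
  have "Re z < 1" using assms complex_Re_le_cmod[of z] by simp
  then have nr: "1 - z \<notin> \<real>\<^sub>\<le>\<^sub>0" by (auto simp: complex_nonpos_Reals_iff)
  have "(extremal has_field_derivative (2 * (1 - z) + 2 * z) / ((1 - z) * (1 - z)) - 1 / (1 - z)) (at z)"
    unfolding extremal_def using \<open>z \<noteq> 1\<close> nr
    by (auto intro!: derivative_eq_intros simp: field_simps)
  moreover have "(2 * (1 - z) + 2 * z) / ((1 - z) * (1 - z)) - 1 / (1 - z) = (1 + z) / (1 - z)\<^sup>2"
    using \<open>z \<noteq> 1\<close> by (simp add: divide_simps power2_eq_square) (simp add: algebra_simps)?
  ultimately show ?thesis by simp
qed

text \<open>This is the half-plane map for \<open>a = 1/2\<close>, translated by
  \<open>- 1/2\<close>.\<close>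

lemma convex_function_halfplane: "convex_function (\<lambda>z. z / (1 - z))"
proof -
  define h where "h = (\<lambda>z::complex. (1/2 + cnj (1/2) * z) / (1 - z))"
  have h: "convex_function h" unfolding h_def by (rule convex_halfplane_map(1)) simp
  have eq: "z / (1 - z) = h z + (-1/2)" if "z \<in> \<D>" for z
  proof -
    have "z \<noteq> 1" using that by auto
    then show ?thesis by (simp add: h_def field_simps)
  qed
  have "(\<lambda>z. z / (1 - z)) ` \<D> = (\<lambda>z. h z + (-1/2)) ` \<D>" using eq by (intro image_cong) auto
  also have "\<dots> = (+) (-1/2) ` h ` \<D>" by (auto simp: image_image add.commute)
  finally have "convex ((\<lambda>z. z / (1 - z)) ` \<D>)"
    using h by (simp add: convex_function_def convex_translation)
  moreover have "inj_on (\<lambda>z. z / (1 - z)) \<D>"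
    using h eq by (auto simp: convex_function_def inj_on_def)
  moreover have "(\<lambda>z. z / (1 - z)) holomorphic_on \<D>" by (intro holomorphic_intros) auto
  ultimately show ?thesis by (simp add: convex_function_def)
qed

lemma extremal_in_C1: "extremal \<in> \<C>\<^sub>1"
proof -
  define g where "g = (\<lambda>z::complex. z / (1 - z))"
  \<comment> \<open>Written with \<open>cnj 1\<close> to match the half-plane map for
    \<open>a = 1\<close>.\<close>
  define q where "q = (\<lambda>z::complex. (1 + cnj 1 * z) / (1 - z))"
  have q: "q holomorphic_on \<D>" and qim: "q ` \<D> = {w. Re w > 0}"
    unfolding q_def using convex_halfplane_map[of 1] by (auto simp: convex_function_def)
  have Re_q: "Re (q z) > 0" if "z \<in> \<D>" for z using qim that by auto
  have qz: "q z = z * deriv extremal z / g z" if z: "z \<in> \<D> - {0}" for z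
  proof -
    have "z \<noteq> 1" "z \<noteq> 0" using z by auto
    moreover have "deriv extremal z = (1 + z) / (1 - z)\<^sup>2"
      by (rule DERIV_imp_deriv[OF deriv_extremal]) (use z in blast)
    ultimately show ?thesis by (simp add: q_def g_def power2_eq_square)
  qed
  have "(g has_field_derivative 1) (at 0)"
    unfolding g_def by (auto intro!: derivative_eq_intros)
  then have "Re (deriv g 0) > 0" by (simp add: DERIV_imp_deriv)
  moreover have "convex_function g" "g 0 = 0" using convex_function_halfplane by (simp_all add: g_def)
  moreover have "extremal holomorphic_on \<D>"
    unfolding holomorphic_on_def field_differentiable_def
    using deriv_extremal has_field_derivative_at_within by blast
  moreover have "extremal 0 = 0" by (simp add: extremal_def)
  moreover have "deriv extremal 0 = 1" using DERIV_imp_deriv[OF deriv_extremal[of 0]] by simp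
  ultimately show ?thesis
    unfolding class_C1_def using q Re_q qz by blast
qed

lemma extremal_taylor_coeff: "taylor_coeff extremal n = of_real (growth_coeff n)"
proof -
  have "extremal has_fps_expansion Abs_fps (\<lambda>n. of_real (growth_coeff n))"
  proof (rule has_fps_expansionI)
    have "eventually (\<lambda>u. u \<in> \<D>) (nhds (0::complex))" by (rule eventually_nhds_in_open) auto
    then show "eventually (\<lambda>u. (\<lambda>n. fps_nth (Abs_fps (\<lambda>n. of_real (growth_coeff n))) n * u ^ n) sums extremal u) (nhds 0)"
      by eventually_elim (simp add: extremal_sums)
  qed
  then show ?thesis by (simp add: fps_expansion_eqI)
qed

text \<open>The value \<open>extremal (-1)\<close> is omitted: by univalence and symmetry a preimage would be real.\<close>

lemma extremal_infdist: "infdist (extremal 0) (frontier (extremal ` \<D>)) \<le> 1 - ln 2"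
proof -
  define w where "w = complex_of_real (growth_majorant (-1))"
  have gm: "growth_majorant (-1) = ln 2 - 1" by (simp add: growth_majorant_def)
  have "ln 2 < (1::real)" by (rule ln_2_less_1)
  then have cw: "cmod w = 1 - ln 2" by (simp add: w_def gm flip: of_real_diff)
  have e0: "extremal 0 = 0" by (simp add: extremal_def)
  have "w \<notin> extremal ` \<D>"
  proof
    assume "w \<in> extremal ` \<D>"
    then obtain z where z: "z \<in> \<D>" "extremal z = w" by auto
    have "Re z < 1" using z(1) complex_Re_le_cmod[of z] by simp
    then have nr: "1 - z \<notin> \<real>\<^sub>\<le>\<^sub>0" by (auto simp: complex_nonpos_Reals_iff)
    have "extremal (cnj z) = cnj (extremal z)" using cnj_Ln[OF nr] by (simp add: extremal_def)
    also have "\<dots> = extremal z" by (simp add: z(2) w_def)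
    finally have "cnj z = z" using inj_onD[OF C1_inj[OF extremal_in_C1], of "cnj z" z] z(1) by simp
    then have zr: "z = of_real (Re z)" by (simp add: complex_eq_iff)
    have "-1 < Re z" using z(1) abs_Re_le_cmod[of z] by simp
    have "of_real (growth_majorant (Re z)) = w"
      using extremal_of_real[OF \<open>Re z < 1\<close>] zr z(2) by simp
    then have "growth_majorant (Re z) = growth_majorant (-1)" by (simp add: w_def)
    then show False using growth_majorant_less[of "-1" "Re z"] \<open>-1 < Re z\<close> \<open>Re z < 1\<close> by simp
  qed
  moreover have "0 \<in> extremal ` \<D>" using e0 by (metis centre_in_ball imageI zero_less_one)
  \<comment> \<open>The segment joins a point of the image to an omitted one, so it meets the
    frontier, at a distance from 0 of at most \<open>|w| = 1 - ln 2\<close>.\<close>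
  ultimately have "closed_segment 0 w \<inter> frontier (extremal ` \<D>) \<noteq> {}"
    by (intro connected_Int_frontier) (auto intro!: connected_segment)
  then obtain p where p: "p \<in> closed_segment 0 w" "p \<in> frontier (extremal ` \<D>)" by auto
  have "infdist (extremal 0) (frontier (extremal ` \<D>)) \<le> dist (extremal 0) p" by (rule infdist_le[OF p(2)])
  also have "\<dots> \<le> 1 - ln 2" using segment_bound(1)[OF p(1)] cw e0 by simp
  finally show ?thesis .
qed

section \<open>The radius, the inequality and its sharpness\<close>

theorem theorem2p7:
  fixes N :: nat
  assumes "N \<ge> 2"
  shows "\<exists>r::real.
    (0 < r \<and> r < 1 \<and> radius_equation N r \<and>
      (\<forall>s. 0 < s \<and> s < 1 \<and> radius_equation N s \<longrightarrow> s = r)) \<and>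
    (\<forall>f\<in>\<C>\<^sub>1. \<forall>z. cmod z \<le> r \<longrightarrow> bohr_inequality N f z) \<and>
    \<not> (\<exists>R>r. \<forall>f\<in>\<C>\<^sub>1. \<forall>z\<in>\<D>. cmod z \<le> R \<longrightarrow> bohr_inequality N f z)"
proof -
  have N: "N > 0" using assms by simp
  obtain r where r: "0 < r" "r < 1" "bohr_majorant N r = 1 - ln 2" using radius_exists[OF N] .
  have unique: "s = r" if "0 < s" "s < 1" "bohr_majorant N s = 1 - ln 2" for s
    using bohr_majorant_less[of r s N] bohr_majorant_less[of s r N] that r
    by (cases s r rule: linorder_cases) auto
  have bohr: "bohr_inequality N f z" if "f \<in> \<C>\<^sub>1" "cmod z \<le> r" for f z
    using C1_bohr_lhs[OF that r(2), of N] C1_infdist_frontier[OF that(1)] r(3)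
    by (simp add: bohr_inequality_def)
  have sharp: "\<exists>f\<in>\<C>\<^sub>1. \<exists>z\<in>\<D>. cmod z \<le> R \<and> \<not> bohr_inequality N f z" if R: "R > r" for R
  proof -
    obtain s where s: "r < s" "s < min R 1" using dense[of r "min R 1"] R r by auto
    have s0: "0 \<le> s" "s < 1" using s r by auto
    \<comment> \<open>The coefficients of \<open>extremal\<close> are nonnegative, so at the real
      point \<open>s\<close> its left-hand side equals \<open>bohr_majorant N s\<close>, which
      exceeds \<open>1 - ln 2\<close> beyond \<open>r\<close>.\<close>
    have "cmod (taylor_coeff extremal (n + N) * of_real s ^ (n + N)) = growth_coeff (n + N) * s ^ (n + N)" for n
      using s0 growth_coeff_nonneg[of "n + N"] by (simp add: extremal_taylor_coeff norm_mult norm_power)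
    then have "(cmod (extremal (of_real s)))\<^sup>2 + (\<Sum>n. cmod (taylor_coeff extremal (n + N) * of_real s ^ (n + N))) = bohr_majorant N s"
      by (simp add: extremal_of_real s0 bohr_majorant_def growth_tail_def)
    moreover have "bohr_majorant N s > 1 - ln 2" using bohr_majorant_less[of r s N] r s by simp
    ultimately have "\<not> bohr_inequality N extremal (of_real s)"
      using extremal_infdist by (simp add: bohr_inequality_def)
    then show ?thesis using extremal_in_C1 s s0 by (intro bexI[of _ extremal] bexI[of _ "of_real s"]) auto
  qed
  show ?thesis
    unfolding radius_equation_iff[OF N]
  proof (intro exI[of _ r] conjI)
    show "\<not> (\<exists>R>r. \<forall>f\<in>\<C>\<^sub>1. \<forall>z\<in>\<D>. cmod z \<le> R \<longrightarrow> bohr_inequality N f z)" using sharp by blast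
  qed (use r unique bohr in blast)+
qed

end
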